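(* The upper bounds $A(\mathcal{E})\le\log\frac{2d}{d+1}$ and $W(\mathcal{P})\le\log\frac{2d}{d+1}$, valid for $d$-dimensional SIC ensembles $\mathcal{E}$ and SIC POVMs $\mathcal{P}$, are tight in dimension $d=2$: the $2$-dimensional SIC ensemble (tetrahedral ensemble) $\mathcal{E}$ and the $2$-dimensional SIC POVM (tetrahedral POVM) $\mathcal{P}$ satisfy $$A(\mathcal{E})=W(\mathcal{P})=\log\frac43 .$$ The accessible information $A(\mathcal{E})$ is achieved by the antitetrahedral POVM, and the informational power $W(\mathcal{P})$ is achieved by the antitetrahedral ensemble.
   Context: $\log$ is the base-2 logarithm. A state is a positive semidefinite operator $\rho$ with $\operatorname{Tr}\rho\le 1$. A discrete ensemble is a family $\mathcal{E}=\{\rho_x\}$ of states indexed by a countable set of real numbers with $\sum_x\operatorname{Tr}[\rho_x]=1$; a continuous ensemble is a measurable function $x\mapsto\rho_x$, from a measurable set of real numbers to states, with $\int dx\,\operatorname{Tr}[\rho_x]=1$. Its average state is $\rho=\sum_x\rho_x$ (resp. $\int dx\,\rho_x$). An effect is an operator $\Pi$ with $0\le\Pi\le\mathbb{1}$. A discrete (resp. continuous) POVM is a family $\mathcal{P}=\{\Pi_y\}$ of effects, indexed by a countable (resp. measurably by a measurable) set of real numbers, with $\sum_y\Pi_y=\mathbb{1}$ (resp. $\int dy\,\Pi_y=\mathbb{1}$). Given $\mathcal{E},\mathcal{P}$ on the same space, let $p(x,y)=\operatorname{Tr}[\rho_x\Pi_y]$, with marginals $p(x)=\operatorname{Tr}[\rho_x]$,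 $p(y)=\operatorname{Tr}[\rho\Pi_y]$; the mutual information is $I(\mathcal{E},\mathcal{P})=\sum_{x,y}p(x,y)\log\frac{p(x,y)}{p(x)p(y)}$, sums being replaced by integrals for continuous indices (terms with $p(x,y)=0$ count as $0$). Accessible information: $A(\mathcal{E})=\sup_{\mathcal{P}}I(\mathcal{E},\mathcal{P})$ over all discrete or continuous POVMs. Informational power: $W(\mathcal{P})=\sup_{\mathcal{E}}I(\mathcal{E},\mathcal{P})$ over all discrete or continuous ensembles. "Achieved by" means that the stated POVM (ensemble) attains the supremum. A $d$-dimensional SIC set of operators is a family $\{X_x\}_{x=1}^{d^2}$ of rank-one positive semidefinite operators on a $d$-dimensional complex Hilbert space such that, for some $\lambda$, $\operatorname{Tr}[X_x]=\lambda$ for all $x$ and $\operatorname{Tr}[X_xX_y]=\frac{\lambda^2}{d+1}$ for $x\neq y$. A SIC ensemble is a SIC set with $\lambda=\frac1{d^2}$; a SIC POVM is a SIC set with $\lambda=\frac1d$. In dimension $2$ the SIC configuration is unique up to unitary equivalence and relabeling: a SIC POVM has the form $\Pi_y=\frac12|\pi_y\rangle\langle\pi_y|$ and a SIC ensemble $\rho_y=\frac14|\pi_y\rangle\langle\pi_y|$, $y=1,\dots,4$, with unit vectors, up to unitary and relabeling, $|\pi_1\rangle=|0\rangle$, $|\pi_2\rangle=\frac1{\sqrt3}|0\rangle+\sqrt{\frac23}|1\rangle$, $|\pi_3\rangle=\frac1{\sqrt3}|0\rangle+e^{2\pi i/3}\sqrt{\frac23}|1\rangle$, $|\pi_4\rangle=\frac1{\sqrt3}|0\rangle+e^{-2\pi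 i/3}\sqrt{\frac23}|1\rangle$, where $\{|0\rangle,|1\rangle\}$ is an orthonormal basis. The associated antitetrahedral ensemble is $\{\frac14|\psi_x\rangle\langle\psi_x|\}_{x=1}^4$ and the antitetrahedral POVM is $\{\frac12|\psi_x\rangle\langle\psi_x|\}_{x=1}^4$, where the unit vectors $\psi_x$ are those orthogonal to the $\pi_y$'s: $|\psi_1\rangle=|1\rangle$, $|\psi_2\rangle=\sqrt{\frac23}|0\rangle-\frac1{\sqrt3}|1\rangle$, $|\psi_3\rangle=\sqrt{\frac23}|0\rangle+e^{i\pi/3}\frac1{\sqrt3}|1\rangle$, $|\psi_4\rangle=\sqrt{\frac23}|0\rangle+e^{-i\pi/3}\frac1{\sqrt3}|1\rangle$. *)

theory Defs
  imports "HOL-Analysis.Analysis"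
begin

section \<open>Operators on a finite-dimensional complex Hilbert space\<close>

text \<open>
  The \<open>d\<close>-dimensional Hilbert space is \<^typ>\<open>complex^'n\<close> with \<open>d = CARD('n)\<close>; its norm is the
  Euclidean one, i.e. the one induced by the following inner product.
\<close>

definition cinner :: "complex^'n \<Rightarrow> complex^'n \<Rightarrow> complex" where
  "cinner u v = (\<Sum>i\<in>UNIV. cnj (u $ i) * v $ i)"

definition ketbra :: "complex^'n \<Rightarrow> complex^'n^'n" where
  "ketbra v = (\<chi> i j. v $ i * cnj (v $ j))"

definition hermitian :: "complex^'n^'n \<Rightarrow> bool" where
  "hermitian A \<longleftrightarrow> transpose (map_matrix cnj A) = A"

definition psd :: "complex^'n^'n \<Rightarrow> bool" where
  "psd A \<longleftrightarrow> hermitian A \<and> (\<forall>v. 0 \<le> Re (cinner v (A *v v)))"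

definition state :: "complex^'n^'n \<Rightarrow> bool" where
  "state \<rho> \<longleftrightarrow> psd \<rho> \<and> Re (trace \<rho>) \<le> 1"

definition effect :: "complex^'n^'n \<Rightarrow> bool" where
  "effect Q \<longleftrightarrow> psd Q \<and> psd (mat 1 - Q)"

section \<open>Ensembles and POVMs\<close>

text \<open>
  An indexed family is a pair of an index measure and a function. The index measure is counting
  measure on a countable set of reals (discrete case: integrals are absolutely convergent sums)
  or Lebesgue measure on a Lebesgue measurable set of reals (continuous case).
\<close>

definition index_measure :: "real measure \<Rightarrow> bool" where
  "index_measure M \<longleftrightarrow>
     (\<exists>S. countable S \<and> M = count_space S) \<or> (\<exists>S\<in>sets lebesgue. M = lebesgue_on S)"

definition ensemble :: "real measure \<Rightarrow> (real \<Rightarrow> complex^'n^'n) \<Rightarrow> bool" where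
  "ensemble M \<rho> \<longleftrightarrow>
     index_measure M \<and> \<rho> \<in> borel_measurable M \<and> (\<forall>x\<in>space M. state (\<rho> x)) \<and>
     has_bochner_integral M (\<lambda>x. trace (\<rho> x)) 1"

definition average_state :: "real measure \<Rightarrow> (real \<Rightarrow> complex^'n^'n) \<Rightarrow> complex^'n^'n" where
  "average_state M \<rho> = (LINT x|M. \<rho> x)"

definition povm :: "real measure \<Rightarrow> (real \<Rightarrow> complex^'n^'n) \<Rightarrow> bool" where
  "povm N Q \<longleftrightarrow>
     index_measure N \<and> Q \<in> borel_measurable N \<and> (\<forall>y\<in>space N. effect (Q y)) \<and>
     has_bochner_integral N Q (mat 1)"

section \<open>Mutual information, accessible information, informational power\<close>

text \<open>Where \<open>p(x,y) = 0\<close> the value is \<open>0\<close>, because of the first factor.\<close>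

definition mutual_information_integrand ::
  "real measure \<Rightarrow> (real \<Rightarrow> complex^'n^'n) \<Rightarrow> (real \<Rightarrow> complex^'n^'n) \<Rightarrow> real \<times> real \<Rightarrow> real" where
  "mutual_information_integrand M \<rho> Q = (\<lambda>(x, y).
     let pxy = Re (trace (\<rho> x ** Q y));
         px = Re (trace (\<rho> x));
         py = Re (trace (average_state M \<rho> ** Q y))
     in pxy * log 2 (pxy / (px * py)))"

text \<open>
  The integral over both indices is taken as the difference of the integrals of the positive and
  negative parts, so that no integrability is presupposed. Since \<open>t ln t \<ge> t - 1\<close>, the negative part
  always has a finite integral and \<open>\<infinity> - \<infinity>\<close> does not occur for an ensemble and a POVM.
\<close>

definition mutual_info ::
  "real measure \<Rightarrow> (real \<Rightarrow> complex^'n^'n) \<Rightarrow> real measure \<Rightarrow> (real \<Rightarrow> complex^'n^'n) \<Rightarrow> ereal" where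
  "mutual_info M \<rho> N Q =
     enn2ereal (\<integral>\<^sup>+z. ennreal (mutual_information_integrand M \<rho> Q z) \<partial>(M \<Otimes>\<^sub>M N))
     - enn2ereal (\<integral>\<^sup>+z. ennreal (- mutual_information_integrand M \<rho> Q z) \<partial>(M \<Otimes>\<^sub>M N))"

definition accessible_information :: "real measure \<Rightarrow> (real \<Rightarrow> complex^'n^'n) \<Rightarrow> ereal" where
  "accessible_information M \<rho> = (SUP (N, Q)\<in>{(N, Q). povm N Q}. mutual_info M \<rho> N Q)"

definition informational_power :: "real measure \<Rightarrow> (real \<Rightarrow> complex^'n^'n) \<Rightarrow> ereal" where
  "informational_power N Q = (SUP (M, \<rho>)\<in>{(M, \<rho>). ensemble M \<rho>}. mutual_info M \<rho> N Q)"

section \<open>SIC sets\<close>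

text \<open>The index set \<open>{1, \<dots>, m}\<close> as a set of real numbers, and counting measure on it.\<close>

abbreviation upto_index :: "nat \<Rightarrow> real set" where
  "upto_index m \<equiv> real ` {1..m}"

abbreviation upto_measure :: "nat \<Rightarrow> real measure" where
  "upto_measure m \<equiv> count_space (upto_index m)"

definition sic_set :: "real \<Rightarrow> (real \<Rightarrow> complex^'n^'n) \<Rightarrow> bool" where
  "sic_set t X \<longleftrightarrow>
     (\<forall>x\<in>upto_index (CARD('n)\<^sup>2). psd (X x) \<and> rank (X x) = 1 \<and> trace (X x) = of_real t) \<and>
     (\<forall>x\<in>upto_index (CARD('n)\<^sup>2). \<forall>y\<in>upto_index (CARD('n)\<^sup>2). x \<noteq> y \<longrightarrow>
        trace (X x ** X y) = of_real (t\<^sup>2 / (real CARD('n) + 1)))"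

definition sic_ensemble :: "(real \<Rightarrow> complex^'n^'n) \<Rightarrow> bool" where
  "sic_ensemble \<rho> \<longleftrightarrow> sic_set (1 / (real CARD('n))\<^sup>2) \<rho>"

definition sic_povm :: "(real \<Rightarrow> complex^'n^'n) \<Rightarrow> bool" where
  "sic_povm Q \<longleftrightarrow> sic_set (1 / real CARD('n)) Q"

section \<open>The antitetrahedral configuration\<close>

text \<open>
  For \<open>X\<close> a SIC set in dimension 2, \<open>\<psi>\<close> lists unit vectors orthogonal to the unit vectors \<open>\<pi>\<close>
  spanning the ranges of the \<open>X y\<close>, up to a relabeling \<open>\<sigma>\<close>.
\<close>

definition antitetrahedral :: "(real \<Rightarrow> complex^'n^'n) \<Rightarrow> (real \<Rightarrow> complex^'n) \<Rightarrow> bool" where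
  "antitetrahedral X \<psi> \<longleftrightarrow>
     (\<exists>\<pi> \<sigma>. (\<forall>y\<in>upto_index 4. norm (\<pi> y) = 1 \<and> (\<exists>c::real. X y = c *\<^sub>R ketbra (\<pi> y))) \<and>
            bij_betw \<sigma> (upto_index 4) (upto_index 4) \<and>
            (\<forall>x\<in>upto_index 4. norm (\<psi> x) = 1 \<and> cinner (\<pi> (\<sigma> x)) (\<psi> x) = 0))"

subsection \<open>The standard tetrahedral configuration is an instance\<close>

definition tetra :: "real \<Rightarrow> complex^2" where
  "tetra y =
     (if y = 1 then vector [1, 0]
      else if y = 2 then vector [1 / sqrt 3, sqrt (2/3)]
      else if y = 3 then vector [1 / sqrt 3, cis (2 * pi / 3) * sqrt (2/3)]
      else vector [1 / sqrt 3, cis (- 2 * pi / 3) * sqrt (2/3)])"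

definition antitetra :: "real \<Rightarrow> complex^2" where
  "antitetra x =
     (if x = 1 then vector [0, 1]
      else if x = 2 then vector [sqrt (2/3), - 1 / sqrt 3]
      else if x = 3 then vector [sqrt (2/3), cis (pi / 3) * (1 / sqrt 3)]
      else vector [sqrt (2/3), cis (- pi / 3) * (1 / sqrt 3)])"

lemma scaled_ketbra_nth: "(c *\<^sub>R ketbra v) $ i $ j = of_real c * (v $ i * cnj (v $ j))"
  by (simp add: ketbra_def vector_scaleR_component) (simp add: scaleR_conv_of_real)

lemma hermitian_ketbra: "hermitian (c *\<^sub>R ketbra v)"
  unfolding hermitian_def
  by (simp only: vec_eq_iff transpose_def vec_lambda_beta nth_map_matrix scaled_ketbra_nth) simp

lemma psd_ketbra:
  assumes "0 \<le> c"
  shows "psd (c *\<^sub>R ketbra v)"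
proof -
  have "0 \<le> Re (cinner w ((c *\<^sub>R ketbra v) *v w))" for w
  proof -
    have "((c *\<^sub>R ketbra v) *v w) $ i = of_real c * cinner v w * v $ i" for i
      unfolding matrix_vector_mult_def vec_lambda_beta scaled_ketbra_nth
      by (simp add: cinner_def sum_distrib_left sum_distrib_right mult_ac)
    then have "cinner w ((c *\<^sub>R ketbra v) *v w) = of_real c * (cinner w v * cinner v w)"
      by (subst cinner_def) (simp add: cinner_def[of w v] sum_distrib_left sum_distrib_right mult_ac)
    also have "cinner w v = cnj (cinner v w)"
      by (simp add: cinner_def mult.commute)
    also have "cnj (cinner v w) * cinner v w = of_real ((cmod (cinner v w))\<^sup>2)"
      by (metis complex_norm_square mult.commute of_real_power)
    finally show ?thesis using assms by simp
  qed
  then show ?thesis by (simp add: psd_def hermitian_ketbra)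
qed

lemma rank_ketbra:
  fixes v :: "complex^'n"
  assumes "c \<noteq> 0" "v \<noteq> 0"
  shows "rank (c *\<^sub>R ketbra v) = 1"
proof -
  let ?w = "\<chi> j. cnj (v $ j)"
  let ?R = "rows (c *\<^sub>R ketbra v)"
  have row: "row i (c *\<^sub>R ketbra v) = (of_real c * v $ i) *s ?w" for i
    unfolding row_def scaled_ketbra_nth by (simp add: vec_eq_iff mult.assoc)
  obtain k where k: "v $ k \<noteq> 0"
    using assms(2) by (auto simp: vec_eq_iff)
  have w: "?w \<noteq> 0" using k by (auto simp: vec_eq_iff)
  have 1: "?R \<subseteq> vec.span {?w}"
    using vec.span_scale[OF vec.span_base[of ?w "{?w}"]] by (auto simp: rows_def row)
  have "row k (c *\<^sub>R ketbra v) \<in> ?R"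
    by (auto simp: rows_def)
  then have "inverse (of_real c * v $ k) *s row k (c *\<^sub>R ketbra v) \<in> vec.span ?R"
    by (intro vec.span_scale vec.span_base)
  moreover have "inverse (of_real c * v $ k) *s row k (c *\<^sub>R ketbra v) = ?w"
    using k assms(1) by (simp add: row vec_eq_iff field_simps)
  ultimately have "?w \<in> vec.span ?R" by simp
  with 1 have "vec.span ?R = vec.span {?w}"
    by (subst vec.span_eq) auto
  then have "vec.dim ?R = vec.dim {?w}"
    by (metis vec.dim_span)
  also have "\<dots> = 1"
    using w by (subst vec.dim_eq_card_independent) auto
  finally show ?thesis by (simp add: row_rank_def_gen)
qed

lemma trace_ketbra: "trace (c *\<^sub>R ketbra v) = of_real (c * (norm v)\<^sup>2)"
proof -
  have "trace (c *\<^sub>R ketbra v) = of_real c * (\<Sum>i\<in>UNIV. of_real ((cmod (v $ i))\<^sup>2))"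
    unfolding trace_def scaled_ketbra_nth
    by (simp add: complex_norm_square sum_distrib_left del: of_real_power)
  also have "(\<Sum>i\<in>UNIV. (cmod (v $ i))\<^sup>2) = (norm v)\<^sup>2"
    by (simp add: norm_vec_def L2_set_def sum_nonneg)
  then have "(\<Sum>i\<in>UNIV. complex_of_real ((cmod (v $ i))\<^sup>2)) = of_real ((norm v)\<^sup>2)"
    by (simp only: of_real_sum[symmetric])
  finally show ?thesis by simp
qed

lemma trace_ketbra_mult:
  "trace ((c *\<^sub>R ketbra u) ** (c *\<^sub>R ketbra v)) = of_real (c\<^sup>2 * (cmod (cinner u v))\<^sup>2)"
proof -
  have "of_real ((cmod (cinner u v))\<^sup>2) = cinner u v * cnj (cinner u v)"
    by (simp only: complex_norm_square)
  then show ?thesis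
    unfolding trace_def matrix_matrix_mult_def vec_lambda_beta scaled_ketbra_nth
    by (simp add: cinner_def sum_product sum_distrib_left power2_eq_square mult_ac)
      (rule sum.swap)
qed

lemma upto_index_4: "upto_index 4 = {1, 2, 3, 4}"
proof -
  have "{1..4::nat} = {1, 2, 3, 4}" by auto
  then show ?thesis by simp
qed

lemma cis_60_120:
  "cis (2 * pi / 3) = Complex (- 1 / 2) (sqrt 3 / 2)"
  "cis (- 2 * pi / 3) = Complex (- 1 / 2) (- sqrt 3 / 2)"
  "cis (pi / 3) = Complex (1 / 2) (sqrt 3 / 2)"
  "cis (- pi / 3) = Complex (1 / 2) (- sqrt 3 / 2)"
  by (simp_all add: cis.ctr cos_120 sin_120 cos_60 sin_60)

lemma norm_tetra: "norm (tetra y) = 1" "norm (antitetra y) = 1"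
  by (simp_all add: tetra_def antitetra_def norm_vec_def L2_set_def sum_2 norm_mult norm_divide
      power_mult_distrib power_divide)

lemma sqrt_2_3: "sqrt 2 * (sqrt 2 * x) = 2 * x" "sqrt 3 * (sqrt 3 * x) = 3 * x"
  by (simp_all flip: mult.assoc)

lemma cinner_tetra:
  assumes "x \<in> {1, 2, 3, 4}" "y \<in> {1, 2, 3, 4}" "x \<noteq> y"
  shows "(cmod (cinner (tetra x) (tetra y)))\<^sup>2 = 1 / 3"
  using assms unfolding tetra_def cis_60_120 cmod_power2
  by (auto simp: cinner_def sum_2 real_sqrt_divide)
    (auto simp: power2_eq_square field_simps sqrt_2_3)

lemma sic_set_tetra:
  assumes "0 < c"
  shows "sic_set c (\<lambda>y. c *\<^sub>R ketbra (tetra y))"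
proof -
  have "tetra y \<noteq> 0" for y using norm_tetra(1)[of y] by auto
  moreover have card: "CARD(2)\<^sup>2 = 4" by simp
  ultimately show ?thesis
    using assms unfolding sic_set_def card upto_index_4
    by (simp add: psd_ketbra rank_ketbra trace_ketbra trace_ketbra_mult norm_tetra cinner_tetra
        del: of_real_power of_real_mult of_real_divide)
qed

lemma sic_ensemble_tetra: "sic_ensemble (\<lambda>y. (1 / 4) *\<^sub>R ketbra (tetra y))"
  using sic_set_tetra[of "1/4"] by (simp add: sic_ensemble_def)

lemma sic_povm_tetra: "sic_povm (\<lambda>y. (1 / 2) *\<^sub>R ketbra (tetra y))"
  using sic_set_tetra[of "1/2"] by (simp add: sic_povm_def)

text \<open>With the phases above, \<open>antitetra 3\<close> is orthogonal to \<open>tetra 4\<close> and \<open>antitetra 4\<close> to \<open>tetra 3\<close>.\<close>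

lemma antitetrahedral_antitetra: "antitetrahedral (\<lambda>y. c *\<^sub>R ketbra (tetra y)) antitetra"
proof -
  let ?\<sigma> = "\<lambda>x::real. if x = 3 then 4 else if x = 4 then 3 else x"
  have "bij_betw ?\<sigma> {1, 2, 3, 4} {1, 2, 3, 4}"
    by (rule bij_betwI[where g = ?\<sigma>]) auto
  moreover have "cinner (tetra (?\<sigma> x)) (antitetra x) = 0" if "x \<in> {1, 2, 3, 4}" for x
    using that unfolding tetra_def antitetra_def cis_60_120
    by (auto simp: cinner_def sum_2 complex_eq_iff real_sqrt_divide field_simps sqrt_2_3)
  ultimately show ?thesis
    unfolding antitetrahedral_def upto_index_4
    by (intro exI[of _ tetra] exI[of _ ?\<sigma>]) (auto simp: norm_tetra)
qed

end

theory Submission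
  imports Defs
begin

text \<open>
  The real inner product on matrices is \<open>Re (trace (A ** B))\<close> for hermitian \<open>A\<close>. In it the traceless
  parts of a SIC set are the vertices of a regular simplex, and \<open>Tr A\<^sup>2 \<le> (Tr A)\<^sup>2\<close> for positive
  semidefinite \<open>A\<close>; this bounds the collision probability of the outcomes of a SIC on any state by
  \<open>2 / (d (d + 1))\<close>. By Jensen's inequality the relative entropy of the outcome distribution to the
  uniform distribution is at most \<open>log (d\<^sup>2 \<cdot> 2 / (d (d + 1)))\<close>, and its average dominates the
  mutual information. For \<open>d = 2\<close> the antitetrahedral operators are complements of SIC operators,
  so each outcome excludes one index and is uniform on the other three, which attains the bound.
\<close>

section \<open>Hermitian matrices and the real inner product\<close>

lemma hermitian_nth: "hermitian A \<Longrightarrow> A $ j $ i = cnj (A $ i $ j)"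
  unfolding hermitian_def by (auto simp: transpose_def vec_eq_iff)

lemma inner_matrix: "A \<bullet> B = (\<Sum>i\<in>UNIV. \<Sum>j\<in>UNIV. Re (cnj (A $ i $ j) * B $ i $ j))"
  for A B :: "complex^'n^'m"
  by (simp add: inner_vec_def inner_complex_def)

text \<open>The Euclidean inner product conjugates its first factor entrywise; for a hermitian
  matrix this amounts to transposing it, which is the pairing in a trace. Probabilities thereby
  become values of a real inner product.\<close>

lemma Re_trace_mult_eq_inner:
  assumes "hermitian A"
  shows "Re (trace (A ** B)) = A \<bullet> B"
proof -
  have "Re (trace (A ** B)) = (\<Sum>i\<in>UNIV. \<Sum>j\<in>UNIV. Re (A $ i $ j * B $ j $ i))"
    by (simp add: trace_def matrix_matrix_mult_def)
  also have "\<dots> = (\<Sum>j\<in>UNIV. \<Sum>i\<in>UNIV. Re (A $ i $ j * B $ j $ i))"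
    by (rule sum.swap)
  finally show ?thesis
    by (simp add: inner_matrix hermitian_nth[OF assms, symmetric] del: times_complex.sel)
qed

lemma Re_trace_eq_inner: "Re (trace A) = A \<bullet> mat 1"
proof -
  have "A \<bullet> mat 1 = (\<Sum>i\<in>UNIV. \<Sum>j\<in>UNIV. if i = j then Re (A $ i $ j) else 0)"
    unfolding inner_matrix by (intro sum.cong refl) (simp add: mat_def)
  then show ?thesis by (simp add: trace_def)
qed

lemma inner_mat_1: "(mat 1 :: complex^'n^'n) \<bullet> mat 1 = CARD('n)"
  by (simp flip: Re_trace_eq_inner add: trace_I)

lemma psd_hermitian: "psd A \<Longrightarrow> hermitian A"
  by (simp add: psd_def)

lemma inner_ketbra: "A \<bullet> ketbra v = Re (cinner v (A *v v))" if "hermitian A"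
proof -
  have "trace (A ** ketbra v) = cinner v (A *v v)"
    by (simp add: trace_def matrix_matrix_mult_def ketbra_def cinner_def matrix_vector_mult_def
        sum_distrib_left mult_ac)
  with Re_trace_mult_eq_inner[OF that, of "ketbra v"] show ?thesis by simp
qed

lemma inner_ketbra_nonneg: "psd A \<Longrightarrow> 0 \<le> A \<bullet> ketbra v"
  by (simp add: inner_ketbra psd_def)

lemma inner_ketbra_ketbra: "ketbra u \<bullet> ketbra v = (cmod (cinner u v))\<^sup>2"
  using trace_ketbra_mult[of 1 u v] Re_trace_mult_eq_inner[of "ketbra u" "ketbra v"]
    hermitian_ketbra[of 1 u]
  by (simp del: of_real_power)

lemma inner_ketbra_mat_1: "ketbra v \<bullet> mat 1 = (norm v)\<^sup>2"
  using trace_ketbra[of 1 v] by (simp flip: Re_trace_eq_inner del: of_real_power)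

lemma cinner_self: "cinner v v = of_real ((norm v)\<^sup>2)"
proof -
  have "cinner v v = (\<Sum>i\<in>UNIV. of_real ((cmod (v $ i))\<^sup>2))"
    unfolding cinner_def complex_norm_square by (simp add: mult.commute)
  also have "(\<Sum>i\<in>UNIV. (cmod (v $ i))\<^sup>2) = (norm v)\<^sup>2"
    by (simp add: norm_vec_def L2_set_def sum_nonneg)
  then have "(\<Sum>i\<in>UNIV. complex_of_real ((cmod (v $ i))\<^sup>2)) = of_real ((norm v)\<^sup>2)"
    by (simp only: of_real_sum[symmetric])
  finally show ?thesis .
qed

lemma hermitian_mat_1: "hermitian (mat 1)"
  by (simp add: hermitian_def transpose_def vec_eq_iff mat_def)

lemma psd_mat_1: "psd (mat 1 :: complex^'n^'n)"
proof -
  have "Re (cinner v v) \<ge> 0" for v :: "complex^'n"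
    by (simp add: cinner_self del: of_real_power)
  then show ?thesis by (simp add: psd_def hermitian_mat_1)
qed

section \<open>Positive semidefinite matrices and rank-one matrices\<close>

lemma hermitian_add: "hermitian A \<Longrightarrow> hermitian B \<Longrightarrow> hermitian (A + B)"
  by (auto simp: hermitian_def transpose_def vec_eq_iff)

lemma hermitian_scaleR: "hermitian A \<Longrightarrow> hermitian (c *\<^sub>R A)"
  by (auto simp: hermitian_def transpose_def vec_eq_iff)

text \<open>Positivity as a family of linear inequalities, so that closure under sums and
  nonnegative multiples is immediate.\<close>

lemma psd_iff_inner: "psd A \<longleftrightarrow> hermitian A \<and> (\<forall>v. 0 \<le> A \<bullet> ketbra v)"
  by (auto simp: psd_def inner_ketbra)

lemma psd_add: "psd A \<Longrightarrow> psd B \<Longrightarrow> psd (A + B)"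
  by (simp add: psd_iff_inner hermitian_add inner_left_distrib)

lemma psd_scaleR: "psd A \<Longrightarrow> 0 \<le> c \<Longrightarrow> psd (c *\<^sub>R A)"
  by (simp add: psd_iff_inner hermitian_scaleR)

text \<open>The quadratic form, restricted to vectors supported on the indices \<open>i\<close> and
  \<open>j\<close>, is nonnegative, so its discriminant has the right sign.\<close>

lemma psd_minor:
  fixes A :: "complex^'n^'n"
  assumes "psd A"
  shows "(cmod (A $ i $ j))\<^sup>2 \<le> Re (A $ i $ i) * Re (A $ j $ j)"
proof -
  note herm = hermitian_nth[OF psd_hermitian[OF assms]]
  define c where "c = A $ i $ j"
  define a where "a = Re (A $ i $ i)"
  define b where "b = Re (A $ j $ j)"
  have diag: "A $ k $ k = of_real (Re (A $ k $ k))" for k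
    using herm[of k k] by (simp add: complex_eq_iff)
  show ?thesis
  proof (cases "i = j")
    case True
    moreover have "cmod (A $ j $ j) = \<bar>Re (A $ j $ j)\<bar>" by (metis diag norm_of_real)
    ultimately show ?thesis by (simp add: power2_eq_square)
  next
    case False
    have di: "A $ i $ i = of_real a" and dj: "A $ j $ j = of_real b"
      unfolding a_def b_def by (rule diag)+
    have form: "0 \<le> a * (cmod x)\<^sup>2 + b * (cmod y)\<^sup>2 + 2 * Re (cnj x * c * y)" for x y
    proof -
      define v :: "complex^'n" where "v = (\<chi> k. if k = i then x else if k = j then y else 0)"
      have two: "(\<Sum>k\<in>UNIV. f k) = f i + f j" if "\<And>k. k \<noteq> i \<Longrightarrow> k \<noteq> j \<Longrightarrow> f k = 0"
        for f :: "'n \<Rightarrow> complex"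
      proof -
        have "(\<Sum>k\<in>UNIV. f k) = (\<Sum>k\<in>{i, j}. f k)"
          by (rule sum.mono_neutral_right) (use that in auto)
        with False show ?thesis by simp
      qed
      have Av: "(A *v v) $ k = A $ k $ i * x + A $ k $ j * y" for k
        unfolding matrix_vector_mult_def vec_lambda_beta
        by (subst two) (use False in \<open>auto simp: v_def\<close>)
      have "cinner v (A *v v) = cnj x * (A $ i $ i * x + c * y) + cnj y * (cnj c * x + A $ j $ j * y)"
        unfolding cinner_def Av
        by (subst two) (use False in \<open>auto simp: v_def c_def herm[of i j]\<close>)
      moreover have "0 \<le> Re (cinner v (A *v v))"
        using assms by (simp add: psd_def)
      ultimately show ?thesis
        unfolding di dj cmod_power2 by (simp add: algebra_simps power2_eq_square)
    qed
    have cc: "Re c * Re c + Im c * Im c = (cmod c)\<^sup>2"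
      unfolding cmod_power2 by (simp only: power2_eq_square)
    have "0 \<le> a" "0 \<le> b" using form[of 1 0] form[of 0 1] by simp_all
    show ?thesis
    proof (cases "a = 0")
      case True
      \<comment> \<open>With \<open>a = 0\<close> the form is affine in \<open>s\<close>, hence
        unbounded below unless \<open>c = 0\<close>; the value of \<open>s\<close> chosen next would
        make it \<open>-1\<close>.\<close>
      have "0 \<le> b - 2 * s * (cmod c)\<^sup>2" for s :: real
        using form[of "- of_real s * c" 1] True
        by (simp add: cc[symmetric] algebra_simps)
      from this[of "(b + 1) / (2 * (cmod c)\<^sup>2)"] have "c = 0"
        by (cases "c = 0") simp_all
      then show ?thesis using \<open>0 \<le> a\<close> \<open>0 \<le> b\<close> by (simp add: a_def b_def c_def)
    next
      case nz: False
      \<comment> \<open>For \<open>y = a\<close> the form is minimal at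
        \<open>x = - c\<close>.\<close>
      have "0 \<le> a * (a * b - (cmod c)\<^sup>2)"
        using form[of "- c" "of_real a"]
        by (simp add: cc[symmetric] power2_eq_square[of a] algebra_simps)
      then have "0 \<le> a * b - (cmod c)\<^sup>2"
        using nz \<open>0 \<le> a\<close> by (simp add: zero_le_mult_iff)
      then show ?thesis by (simp add: a_def b_def c_def)
    qed
  qed
qed

text \<open>Summing the \<open>2 x 2\<close> minor inequalities over all index pairs bounds the
  squared norm by a double sum of diagonal products, which factors as the squared trace.\<close>

lemma psd_norm_le:
  fixes A :: "complex^'n^'n"
  assumes "psd A"
  shows "norm A \<le> A \<bullet> mat 1"
proof -
  have "A \<bullet> A = (\<Sum>i\<in>UNIV. \<Sum>j\<in>UNIV. (cmod (A $ i $ j))\<^sup>2)"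
    unfolding inner_matrix by (intro sum.cong refl) (simp add: cmod_power2, simp add: power2_eq_square)
  also have "\<dots> \<le> (\<Sum>i\<in>UNIV. \<Sum>j\<in>UNIV. Re (A $ i $ i) * Re (A $ j $ j))"
    by (intro sum_mono psd_minor assms)
  also have "\<dots> = (A \<bullet> mat 1)\<^sup>2"
    by (simp add: Re_trace_eq_inner[symmetric] trace_def power2_eq_square sum_product)
  finally have "(norm A)\<^sup>2 \<le> (A \<bullet> mat 1)\<^sup>2" by (simp add: power2_norm_eq_inner)
  moreover have "0 \<le> A \<bullet> mat 1"
  proof -
    have "0 \<le> Re (A $ i $ i)" for i
    proof -
      have "(A *v axis i 1) $ i = A $ i $ i"
        by (simp add: matrix_vector_mult_def axis_def if_distrib[of "\<lambda>x. _ * x"] cong: if_cong)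
      moreover have "cinner (axis i 1) w = w $ i" for w :: "complex^'n"
        by (simp add: cinner_def axis_def if_distrib[of cnj] if_distrib[of "\<lambda>x. x * _"] cong: if_cong)
      ultimately show ?thesis
        using assms unfolding psd_def by metis
    qed
    then show ?thesis by (simp add: Re_trace_eq_inner[symmetric] trace_def sum_nonneg)
  qed
  ultimately show ?thesis by (rule power2_le_imp_le)
qed

text \<open>All rows are multiples of one vector, and the nonzero trace provides a nonzero diagonal
  entry. The column through that entry, normalised, is the wanted vector; comparing traces
  identifies the scalar.\<close>

lemma rank_one_hermitian:
  fixes X :: "complex^'n^'n"
  assumes "hermitian X" "rank X = 1" "trace X = of_real t" "t \<noteq> 0"
  obtains v where "norm v = 1" "X = t *\<^sub>R ketbra v"
proof -
  note herm = hermitian_nth[OF assms(1)]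
  obtain B where B: "rows X \<subseteq> vec.span B" "card B = 1"
    using vec.basis_exists[of "rows X"] assms(2) by (metis row_rank_def_gen)
  then obtain w where "B = {w}" by (auto simp: card_1_singleton_iff)
  have "\<exists>c. row i X = c *s w" for i
  proof -
    have "row i X \<in> vec.span {w}"
      using B \<open>B = {w}\<close> by (auto simp: rows_def)
    then show ?thesis by (auto simp: vec.span_singleton)
  qed
  then obtain a where a: "row i X = a i *s w" for i by metis
  have X: "X $ i $ j = a i * w $ j" for i j
    using a[of i] by (simp add: row_def vec_eq_iff)
  obtain k where k: "X $ k $ k \<noteq> 0"
  proof (rule ccontr)
    assume "\<not> thesis"
    then have "X $ k $ k = 0" for k using that by blast
    then have "trace X = 0" by (simp add: trace_def)
    with assms show False by simp
  qed
  define r where "r = Re (X $ k $ k)"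
  have r: "X $ k $ k = of_real r" using herm[of k k] by (simp add: r_def complex_eq_iff)
  define v where "v = (\<chi> i. X $ i $ k)"
  have "X = (1 / r) *\<^sub>R ketbra v"
  proof -
    have "of_real r * X $ i $ j = X $ i $ k * cnj (X $ j $ k)" for i j
    proof -
      \<comment> \<open>The \<open>2 x 2\<close> minors of a rank-one matrix vanish.\<close>
      have "X $ k $ k * X $ i $ j = X $ i $ k * X $ k $ j" by (simp add: X)
      then show ?thesis by (simp only: r herm[of k j])
    qed
    moreover have "r \<noteq> 0" using k r by auto
    ultimately show ?thesis
      unfolding vec_eq_iff scaled_ketbra_nth by (simp add: v_def field_simps)
  qed
  moreover define u where "u = (1 / norm v) *\<^sub>R v"
  have "v \<noteq> 0" using k by (auto simp: v_def vec_eq_iff)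
  then have u: "norm u = 1" "v = norm v *\<^sub>R u" by (simp_all add: u_def)
  have "ketbra (c *\<^sub>R u) = c\<^sup>2 *\<^sub>R ketbra u" for c
    unfolding vec_eq_iff scaled_ketbra_nth
    by (simp add: ketbra_def, simp add: scaleR_conv_of_real power2_eq_square)
  then have "ketbra v = (norm v)\<^sup>2 *\<^sub>R ketbra u" using u(2) by metis
  ultimately have Xu: "X = ((norm v)\<^sup>2 / r) *\<^sub>R ketbra u" by simp
  then have "complex_of_real t = of_real ((norm v)\<^sup>2 / r)"
    using trace_ketbra[of "(norm v)\<^sup>2 / r" u] u(1) assms(3) by simp
  then have "t = (norm v)\<^sup>2 / r" by (simp only: of_real_eq_iff)
  with Xu u(1) that show ?thesis by metis
qed

section \<open>SIC sets as simplices\<close>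

text \<open>The Gram matrix is \<open>\<alpha>\<close> times a projection, so the analysis operator has norm at most
  \<open>sqrt \<alpha>\<close>.\<close>

lemma simplex_bessel:
  fixes Y :: "'i \<Rightarrow> 'v::real_inner"
  assumes S: "finite S" "S \<noteq> {}"
    and gram: "\<And>x y. x \<in> S \<Longrightarrow> y \<in> S \<Longrightarrow> Y x \<bullet> Y y = \<alpha> * ((if x = y then 1 else 0) - 1 / card S)"
    and "0 \<le> \<alpha>"
  shows "(\<Sum>x\<in>S. (Y x \<bullet> v)\<^sup>2) \<le> \<alpha> * (v \<bullet> v)"
proof -
  define a where "a x = Y x \<bullet> v" for x
  define T where "T = (\<Sum>x\<in>S. (a x)\<^sup>2)"
  \<comment> \<open>Recombining the coefficients of \<open>v\<close> gives
    \<open>v \<bullet> w = T\<close>, while the Gram matrix gives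
    \<open>w \<bullet> w \<le> \<alpha> * T\<close>. Cauchy-Schwarz then bounds
    \<open>T * T\<close>, and one factor \<open>T\<close> is cancelled.\<close>
  define w where "w = (\<Sum>x\<in>S. a x *\<^sub>R Y x)"
  have "w \<bullet> w = (\<Sum>x\<in>S. \<Sum>y\<in>S. a x * a y * (Y x \<bullet> Y y))"
    by (simp add: w_def inner_sum_left inner_sum_right sum_distrib_left mult_ac)
       (simp add: inner_commute)
  also have "\<dots> = (\<Sum>x\<in>S. \<Sum>y\<in>S. \<alpha> * (if x = y then a x * a y else 0) - \<alpha> / card S * (a x * a y))"
    by (intro sum.cong refl) (simp add: gram algebra_simps)
  also have "\<dots> = \<alpha> * T - \<alpha> / card S * (\<Sum>x\<in>S. a x)\<^sup>2"
  proof -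
    have "(\<Sum>x\<in>S. \<Sum>y\<in>S. \<alpha> / card S * (a x * a y)) = \<alpha> / card S * (\<Sum>x\<in>S. a x)\<^sup>2"
      unfolding power2_eq_square sum_product by (simp only: sum_distrib_left)
    moreover have "(\<Sum>x\<in>S. \<Sum>y\<in>S. \<alpha> * (if x = y then a x * a y else 0)) = \<alpha> * T"
      using S by (simp add: T_def power2_eq_square flip: sum_distrib_left)
    ultimately show ?thesis by (simp only: sum_subtractf)
  qed
  also have "\<dots> \<le> \<alpha> * T" using \<open>0 \<le> \<alpha>\<close> by simp
  finally have w: "w \<bullet> w \<le> \<alpha> * T" .
  have "v \<bullet> w = T"
    by (simp add: w_def T_def a_def inner_sum_right power2_eq_square inner_commute)
  then have "T\<^sup>2 \<le> (v \<bullet> v) * (w \<bullet> w)" using Cauchy_Schwarz_ineq by metis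
  also have "\<dots> \<le> (v \<bullet> v) * (\<alpha> * T)" using w by (intro mult_left_mono) auto
  finally have *: "T * T \<le> (\<alpha> * (v \<bullet> v)) * T" by (simp add: power2_eq_square mult_ac)
  have "0 \<le> T" by (simp add: T_def sum_nonneg)
  show ?thesis
  proof (cases "T = 0")
    case True
    then show ?thesis using \<open>0 \<le> \<alpha>\<close> by (simp add: T_def a_def)
  next
    case False
    with * \<open>0 \<le> T\<close> have "T \<le> \<alpha> * (v \<bullet> v)" by simp
    then show ?thesis by (simp add: T_def a_def)
  qed
qed

text \<open>The scale \<open>t\<close> is left open so that SIC ensembles
  (\<open>t = 1 / d^2\<close>) and SIC POVMs (\<open>t = 1 / d\<close>) share one
  development.\<close>

locale sic =
  fixes t :: real and X :: "real \<Rightarrow> complex^'n^'n" and S :: "real set" and d :: real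
  assumes sic: "sic_set t X" and t: "0 < t"
  defines "S \<equiv> upto_index (CARD('n)\<^sup>2)" and "d \<equiv> real CARD('n)"
begin

lemma finite_S: "finite S" and card_S: "real (card S) = d\<^sup>2" and d: "0 < d"
  by (simp_all add: S_def d_def card_image inj_on_def)

lemma S_nonempty: "S \<noteq> {}"
  using card_S d by (metis card.empty of_nat_0 less_irrefl zero_less_power)

lemma rank_one:
  assumes "x \<in> S"
  obtains v where "norm v = 1" "X x = t *\<^sub>R ketbra v"
  using rank_one_hermitian[of "X x" t] assms sic t psd_hermitian
  unfolding sic_set_def S_def by (metis less_irrefl)

lemma psd_X: "x \<in> S \<Longrightarrow> psd (X x)"
  using sic unfolding sic_set_def S_def by blast

lemma trace_X: "x \<in> S \<Longrightarrow> trace (X x) = of_real t"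
  using sic unfolding sic_set_def S_def by blast

lemma inner_X_1: "x \<in> S \<Longrightarrow> X x \<bullet> mat 1 = t"
  by (simp add: trace_X flip: Re_trace_eq_inner)

text \<open>Off the diagonal this is the SIC condition; on the diagonal, rank one and trace
  \<open>t\<close> force the value \<open>t^2\<close>.\<close>

lemma inner_X:
  assumes "x \<in> S" "y \<in> S"
  shows "X x \<bullet> X y = t\<^sup>2 / (d + 1) * ((if x = y then d else 0) + 1)"
proof (cases "x = y")
  case True
  obtain v where "norm v = 1" "X x = t *\<^sub>R ketbra v" using rank_one assms by metis
  moreover from this have "ketbra v \<bullet> ketbra v = 1"
    by (simp add: inner_ketbra_ketbra cinner_self)
  ultimately show ?thesis using True d by (simp add: power2_eq_square)
next
  case False
  then have "trace (X x ** X y) = of_real (t\<^sup>2 / (d + 1))"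
    using sic assms unfolding sic_set_def S_def d_def by metis
  then show ?thesis
    using False Re_trace_mult_eq_inner[OF psd_hermitian[OF psd_X[OF assms(1)]], of "X y"]
    by (simp del: of_real_power of_real_divide)
qed

text \<open>Completeness follows from the Gram matrix: the inner products among the sum and
  \<open>mat 1\<close> are all known, and they make the squared distance between the two sides
  zero.\<close>

lemma sum_X: "(\<Sum>x\<in>S. X x) = (d * t) *\<^sub>R mat 1"
proof -
  let ?Z = "(\<Sum>x\<in>S. X x)"
  have "?Z \<bullet> ?Z = (\<Sum>x\<in>S. \<Sum>y\<in>S. t\<^sup>2 / (d + 1) * ((if x = y then d else 0) + 1))"
    unfolding inner_sum_left inner_sum_right by (intro sum.cong refl) (simp add: inner_X)
  also have "\<dots> = (\<Sum>x\<in>S. t\<^sup>2 / (d + 1) * (d + d\<^sup>2))"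
  proof (intro sum.cong refl)
    fix x assume "x \<in> S"
    then have "(\<Sum>y\<in>S. (if x = y then d else 0) + 1) = d + d\<^sup>2"
      by (simp add: sum.distrib finite_S card_S)
    then show "(\<Sum>y\<in>S. t\<^sup>2 / (d + 1) * ((if x = y then d else 0) + 1)) = t\<^sup>2 / (d + 1) * (d + d\<^sup>2)"
      by (simp only: sum_distrib_left[symmetric])
  qed
  also have "\<dots> = t\<^sup>2 / (d + 1) * (d ^ 3 + d ^ 4)"
    by (simp add: card_S power_numeral_reduce algebra_simps add_divide_distrib)
  also have "\<dots> = d ^ 3 * t\<^sup>2" using d by (simp add: field_simps power_numeral_reduce)
  finally have 1: "?Z \<bullet> ?Z = d ^ 3 * t\<^sup>2" .
  have 2: "?Z \<bullet> mat 1 = d\<^sup>2 * t"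
    by (simp add: inner_sum_left inner_X_1 card_S)
  have "(?Z - (d * t) *\<^sub>R mat 1) \<bullet> (?Z - (d * t) *\<^sub>R mat 1)
      = ?Z \<bullet> ?Z - 2 * (d * t) * (?Z \<bullet> mat 1) + (d * t)\<^sup>2 * (mat 1 \<bullet> (mat 1 :: complex^'n^'n))"
    by (simp add: inner_diff inner_commute power2_eq_square algebra_simps)
  also have "\<dots> = 0"
    unfolding 1 2 inner_mat_1 d_def[symmetric] by (simp add: power_numeral_reduce)
  finally show ?thesis by simp
qed

text \<open>The mean of the values \<open>X x \<bullet> A\<close> is \<open>t * \<tau> / d\<close>,
  and their deviations are inner products of traceless parts. \<open>simplex_bessel\<close> bounds
  the sum of squared deviations by the squared norm of the traceless part of
  \<open>A\<close>.\<close>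

lemma sum_squares:
  assumes "psd A"
  shows "d\<^sup>2 * (\<Sum>x\<in>S. (X x \<bullet> A)\<^sup>2) \<le> 2 * d / (d + 1) * (\<Sum>x\<in>S. X x \<bullet> A)\<^sup>2"
proof -
  define \<tau> where "\<tau> = A \<bullet> mat 1"
  define Y where "Y x = X x - (t / d) *\<^sub>R mat 1" for x
  define V where "V = A - (\<tau> / d) *\<^sub>R mat 1"
  let ?\<alpha> = "t\<^sup>2 * d / (d + 1)"
  have one: "mat 1 \<bullet> (mat 1 :: complex^'n^'n) = d"
    by (simp add: inner_mat_1 d_def)
  \<comment> \<open>The diagonal and off-diagonal Gram entries of the traceless parts. Naming the
    reciprocals \<open>u\<close> and \<open>v\<close> makes both identities polynomial, so that
    \<open>algebra\<close> applies.\<close>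
  have *: "s\<^sup>2 / (d + 1) * (d + 1) - s\<^sup>2 / d = s\<^sup>2 * d / (d + 1) * (1 - 1 / d\<^sup>2)"
    and **: "s\<^sup>2 / (d + 1) - s\<^sup>2 / d = s\<^sup>2 * d / (d + 1) * (0 - 1 / d\<^sup>2)" for s
  proof -
    define u v where "u = 1 / (d + 1)" and "v = 1 / d"
    have "u * (d + 1) = 1" "v * d = 1" using d by (simp_all add: u_def v_def)
    then have "s\<^sup>2 * u * (d + 1) - s\<^sup>2 * v = s\<^sup>2 * d * u * (1 - v\<^sup>2)"
      and "s\<^sup>2 * u - s\<^sup>2 * v = s\<^sup>2 * d * u * (0 - v\<^sup>2)" by algebra+
    then show "s\<^sup>2 / (d + 1) * (d + 1) - s\<^sup>2 / d = s\<^sup>2 * d / (d + 1) * (1 - 1 / d\<^sup>2)"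
      and "s\<^sup>2 / (d + 1) - s\<^sup>2 / d = s\<^sup>2 * d / (d + 1) * (0 - 1 / d\<^sup>2)"
      by (simp_all add: u_def v_def power_divide)
  qed
  have "Y x \<bullet> Y y = ?\<alpha> * ((if x = y then 1 else 0) - 1 / card S)" if "x \<in> S" "y \<in> S" for x y
  proof -
    have "Y x \<bullet> Y y = X x \<bullet> X y - t\<^sup>2 / d"
      using d inner_X_1[OF that(1)] inner_X_1[OF that(2)] inner_commute[of "mat 1" "X y"]
      by (simp add: Y_def inner_diff one power2_eq_square)
    then show ?thesis
      using *[of t] **[of t] by (cases "x = y") (simp_all add: inner_X that card_S)
  qed
  then have "(\<Sum>x\<in>S. (Y x \<bullet> V)\<^sup>2) \<le> ?\<alpha> * (V \<bullet> V)"
    using finite_S S_nonempty d by (intro simplex_bessel) auto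
  also have "V \<bullet> V = A \<bullet> A - \<tau>\<^sup>2 / d"
    using d inner_commute[of "mat 1" A]
    by (simp add: V_def inner_diff one power2_eq_square flip: \<tau>_def)
  \<comment> \<open>Positivity of \<open>A\<close> enters here, as the bound on its purity.\<close>
  also have "A \<bullet> A \<le> \<tau>\<^sup>2"
    using psd_norm_le[OF assms] power_mono[of "norm A" \<tau> 2]
    by (simp add: \<tau>_def power2_norm_eq_inner)
  finally have Y: "(\<Sum>x\<in>S. (Y x \<bullet> V)\<^sup>2) \<le> ?\<alpha> * (\<tau>\<^sup>2 - \<tau>\<^sup>2 / d)"
    using d by (simp add: mult_left_mono divide_right_mono)
  have X: "X x \<bullet> A = Y x \<bullet> V + t * \<tau> / d" if "x \<in> S" for x
    using d inner_X_1[OF that] inner_commute[of "mat 1" A]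
    by (simp add: Y_def V_def inner_diff one flip: \<tau>_def)
  have sX: "(\<Sum>x\<in>S. X x \<bullet> A) = d * t * \<tau>"
    using inner_commute[of "mat 1" A] by (simp add: sum_X \<tau>_def flip: inner_sum_left)
  \<comment> \<open>The deviations sum to zero, which removes the cross term from the expanded
    squares.\<close>
  then have sY: "(\<Sum>x\<in>S. Y x \<bullet> V) = 0"
    using d by (simp add: X sum.distrib card_S power2_eq_square)
  have "(\<Sum>x\<in>S. (X x \<bullet> A)\<^sup>2) = (\<Sum>x\<in>S. (Y x \<bullet> V)\<^sup>2 + 2 * t * \<tau> / d * (Y x \<bullet> V) + (t * \<tau> / d)\<^sup>2)"
    by (intro sum.cong refl) (simp add: X power2_eq_square algebra_simps)
  also have "\<dots> = (\<Sum>x\<in>S. (Y x \<bullet> V)\<^sup>2) + (t * \<tau>)\<^sup>2"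
    using d sY by (simp add: sum.distrib card_S power_divide del: times_divide_eq_left flip: sum_distrib_left)
  also have "\<dots> \<le> ?\<alpha> * (\<tau>\<^sup>2 - \<tau>\<^sup>2 / d) + (t * \<tau>)\<^sup>2" using Y by simp
  also have "\<dots> = 2 * d / (d + 1) * (t * \<tau>)\<^sup>2"
  proof -
    define u v where "u = 1 / (d + 1)" and "v = 1 / d"
    have "u * (d + 1) = 1" "v * d = 1" using d by (simp_all add: u_def v_def)
    then have "t\<^sup>2 * d * u * (\<tau>\<^sup>2 - \<tau>\<^sup>2 * v) + (t * \<tau>)\<^sup>2 = 2 * d * u * (t * \<tau>)\<^sup>2"
      by algebra
    then show ?thesis by (simp add: u_def v_def)
  qed
  finally have "d\<^sup>2 * (\<Sum>x\<in>S. (X x \<bullet> A)\<^sup>2) \<le> d\<^sup>2 * (2 * d / (d + 1) * (t * \<tau>)\<^sup>2)"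
    by (intro mult_left_mono) auto
  also have "\<dots> = 2 * d / (d + 1) * (d * t * \<tau>)\<^sup>2"
    by (simp add: power_mult_distrib mult_ac)
  finally show ?thesis by (simp only: sX)
qed

lemma inner_X_nonneg: "x \<in> S \<Longrightarrow> psd A \<Longrightarrow> 0 \<le> X x \<bullet> A"
  by (metis rank_one inner_commute inner_ketbra_nonneg inner_scaleR_right mult_nonneg_nonneg t less_imp_le)

end

section \<open>An entropic bound from a bound on collision probabilities\<close>

text \<open>
  This is \<open>ln u \<le> u - 1\<close> for \<open>u = N p / (q K)\<close> and \<open>u = 1 / (N r)\<close>: the right side is integrable
  without any integrability assumption on the logarithm. For \<open>r = 0\<close> the left side is \<open>0\<close> because
  of \<open>x / 0 = 0\<close> and \<open>ln 0 = 0\<close>, while the second branch could be negative.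
\<close>

lemma log_likelihood_le:
  fixes p q r K N :: real
  assumes "0 \<le> p" "p \<le> q" "0 \<le> r" "0 < K" "0 < N"
  shows "p * ln (p / (q * r)) \<le>
    (if r = 0 then 0 else N / K * (p\<^sup>2 / q) + p * (ln K - 2) + 1 / N * (p / r))"
proof (cases "p = 0 \<or> r = 0")
  case True
  then show ?thesis by auto
next
  case False
  then have pos: "0 < p" "0 < q" "0 < r" using assms by auto
  \<comment> \<open>The three arguments multiply to \<open>p / (q * r)\<close>. Both linear bounds
    are sharp when \<open>p / q = K / N\<close> and \<open>r = 1 / N\<close>, which is what the
    antitetrahedral configuration realises wherever \<open>p\<close> is nonzero.\<close>
  have "ln (p / (q * r)) = ln (N * p / (q * K)) + ln K + ln (1 / (N * r))"
    using pos assms by (simp add: ln_div ln_mult)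
  also have "\<dots> \<le> (N * p / (q * K) - 1) + ln K + (1 / (N * r) - 1)"
    using pos assms by (intro add_mono ln_le_minus_one order_refl) simp_all
  finally have "p * ln (p / (q * r)) \<le> p * ((N * p / (q * K) - 1) + ln K + (1 / (N * r) - 1))"
    using pos by (intro mult_left_mono) auto
  then show ?thesis
    using False by (simp add: algebra_simps power2_eq_square)
qed

text \<open>Domination by \<open>g\<close> makes the positive parts finite. If the negative parts
  are infinite in total, the difference is minus infinity; otherwise each \<open>f s\<close> is
  integrable and integrals can be compared as usual.\<close>

lemma nn_integral_diff_le:
  fixes f g :: "'s \<Rightarrow> 'a \<Rightarrow> real"
  assumes S: "finite S"
    and f: "\<And>s. s \<in> S \<Longrightarrow> f s \<in> borel_measurable M"
    and g: "\<And>s. s \<in> S \<Longrightarrow> integrable M (g s)"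
    and le: "\<And>s x. s \<in> S \<Longrightarrow> x \<in> space M \<Longrightarrow> f s x \<le> g s x"
    and B: "(\<Sum>s\<in>S. \<integral>x. g s x \<partial>M) \<le> B"
  shows "enn2ereal (\<Sum>s\<in>S. \<integral>\<^sup>+x. ennreal (f s x) \<partial>M)
    - enn2ereal (\<Sum>s\<in>S. \<integral>\<^sup>+x. ennreal (- f s x) \<partial>M) \<le> ereal B"
proof -
  let ?P = "\<lambda>s. \<integral>\<^sup>+x. ennreal (f s x) \<partial>M" and ?N = "\<lambda>s. \<integral>\<^sup>+x. ennreal (- f s x) \<partial>M"
  have P: "?P s < \<infinity>" if "s \<in> S" for s
  proof -
    have "?P s \<le> (\<integral>\<^sup>+x. ennreal (norm (g s x)) \<partial>M)"
      using le[OF that] by (intro nn_integral_mono ennreal_leI) (simp add: order_trans[OF _ abs_ge_self])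
    also have "\<dots> < \<infinity>" using g[OF that] by (simp add: integrable_iff_bounded)
    finally show ?thesis .
  qed
  then have sP: "(\<Sum>s\<in>S. ?P s) < \<infinity>" using S by (simp add: sum_Pinfty less_top)
  show ?thesis
  proof (cases "(\<Sum>s\<in>S. ?N s) = \<infinity>")
    case True
    have "enn2ereal (\<Sum>s\<in>S. ?P s) \<noteq> \<infinity>"
      using sP by (metis enn2ereal_eq_top_iff infinity_ennreal_def infinity_ereal_def less_irrefl top_ereal_def)
    with True show ?thesis
      by (cases "enn2ereal (\<Sum>s\<in>S. ?P s)") (auto simp: enn2ereal_top top_ereal_def)
  next
    case False
    then have N: "?N s < \<infinity>" if "s \<in> S" for s
      using that S by (auto simp: less_top)
    have int: "integrable M (f s)" if "s \<in> S" for s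
      using P[OF that] N[OF that] f[OF that] by (auto simp: real_integrable_def)
    have *: "(\<integral>x. f s x \<partial>M) = enn2real (?P s) - enn2real (?N s)" if "s \<in> S" for s
      using real_lebesgue_integral_def[OF int[OF that]] .
    have fin: "enn2ereal (\<Sum>s\<in>S. h s) = ereal (\<Sum>s\<in>S. enn2real (h s))"
      if "\<And>s. s \<in> S \<Longrightarrow> h s < \<infinity>" for h :: "'s \<Rightarrow> ennreal"
    proof -
      have "(\<Sum>s\<in>S. h s) = (\<Sum>s\<in>S. ennreal (enn2real (h s)))"
        using that by (intro sum.cong refl) (simp add: ennreal_enn2real)
      also have "\<dots> = ennreal (\<Sum>s\<in>S. enn2real (h s))" by (simp add: sum_ennreal)
      finally show ?thesis by (simp add: enn2ereal_ennreal sum_nonneg)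
    qed
    have "(\<Sum>s\<in>S. enn2real (?P s)) - (\<Sum>s\<in>S. enn2real (?N s)) = (\<Sum>s\<in>S. \<integral>x. f s x \<partial>M)"
      by (simp add: * sum_subtractf)
    also have "\<dots> \<le> (\<Sum>s\<in>S. \<integral>x. g s x \<partial>M)"
      by (intro sum_mono integral_mono int g le)
    also note B
    finally show ?thesis using P N by (simp add: fin)
  qed
qed

text \<open>Shared by both upper bounds: \<open>s\<close> is the SIC index, \<open>x\<close> the
  arbitrary one. Summing and integrating \<open>log_likelihood_le\<close> gives at most
  \<open>1 + (ln K - 2) + 1\<close>: the collision hypothesis caps the first term, normalisation
  evaluates the second, and the third contributes at most \<open>1 / N\<close> for each
  \<open>s\<close>.\<close>

lemma information_le_log:
  fixes p :: "'s \<Rightarrow> 'a \<Rightarrow> real"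
  assumes S: "finite S" "S \<noteq> {}" and K: "0 < K"
    and int: "\<And>s. s \<in> S \<Longrightarrow> integrable M (p s)"
    and nonneg: "\<And>s x. s \<in> S \<Longrightarrow> x \<in> space M \<Longrightarrow> 0 \<le> p s x"
    and total: "(\<Sum>s\<in>S. \<integral>x. p s x \<partial>M) = 1"
    and collision: "\<And>x. x \<in> space M \<Longrightarrow> real (card S) * (\<Sum>s\<in>S. (p s x)\<^sup>2) \<le> K * (\<Sum>s\<in>S. p s x)\<^sup>2"
    and f: "\<And>s x. s \<in> S \<Longrightarrow> x \<in> space M \<Longrightarrow>
      f s x = p s x * log 2 (p s x / ((\<Sum>s\<in>S. p s x) * (\<integral>x. p s x \<partial>M)))"
  shows "enn2ereal (\<Sum>s\<in>S. \<integral>\<^sup>+x. ennreal (f s x) \<partial>M)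
    - enn2ereal (\<Sum>s\<in>S. \<integral>\<^sup>+x. ennreal (- f s x) \<partial>M) \<le> ereal (log 2 K)"
proof -
  define N where "N = real (card S)"
  have N: "0 < N" using S by (simp add: N_def card_gt_0_iff)
  define q where "q x = (\<Sum>s\<in>S. p s x)" for x
  define r where "r s = (\<integral>x. p s x \<partial>M)" for s
  define h where "h s x =
    (if r s = 0 then 0 else N / K * ((p s x)\<^sup>2 / q x) + p s x * (ln K - 2) + 1 / N * (p s x / r s))"
    for s x
  have [measurable]: "p s \<in> borel_measurable M" if "s \<in> S" for s using int[OF that] by simp
  have [measurable]: "q \<in> borel_measurable M" unfolding q_def by measurable
  have le_q: "p s x \<le> q x" if "s \<in> S" "x \<in> space M" for s x
    unfolding q_def using S that nonneg by (intro member_le_sum) auto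
  have r: "0 \<le> r s" if "s \<in> S" for s
    unfolding r_def using nonneg[OF that] by (intro integral_nonneg_AE) auto
  \<comment> \<open>These bounds make \<open>p^2 / q\<close> integrable. Where
    \<open>q x = 0\<close>, the quotient is \<open>0\<close> by the convention for division.\<close>
  have sq: "0 \<le> (p s x)\<^sup>2 / q x" "(p s x)\<^sup>2 / q x \<le> p s x" if "s \<in> S" "x \<in> space M" for s x
  proof -
    show "0 \<le> (p s x)\<^sup>2 / q x" using nonneg[OF that] le_q[OF that] by simp
    show "(p s x)\<^sup>2 / q x \<le> p s x"
      using nonneg[OF that] le_q[OF that]
      by (cases "q x = 0") (auto simp: power2_eq_square field_simps intro: mult_right_mono)
  qed
  have int_sq: "integrable M (\<lambda>x. (p s x)\<^sup>2 / q x)" if "s \<in> S" for s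
  proof (rule Bochner_Integration.integrable_bound[OF int[OF that]])
    show "AE x in M. norm ((p s x)\<^sup>2 / q x) \<le> norm (p s x)"
      using sq[OF that] nonneg[OF that] by (intro AE_I2) (simp only: real_norm_def abs_of_nonneg)
  qed (use that in measurable)
  have int_h: "integrable M (h s)" if "s \<in> S" for s
    unfolding h_def using that
    by (cases "r s = 0")
       (auto intro!: Bochner_Integration.integrable_add integrable_mult_right integrable_mult_left
          integrable_divide int int_sq simp del: times_divide_eq_left times_divide_eq_right)
  have "(\<integral>x. h s x \<partial>M) \<le> N / K * (\<integral>x. (p s x)\<^sup>2 / q x \<partial>M) + r s * (ln K - 2) + 1 / N"
    if "s \<in> S" for s
  proof (cases "r s = 0")
    \<comment> \<open>Here \<open>h s\<close> vanishes identically and the right side is still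
      nonnegative.\<close>
    case True
    have "0 \<le> (\<integral>x. (p s x)\<^sup>2 / q x \<partial>M)"
      using sq[OF that] by (intro integral_nonneg_AE) auto
    with True N K show ?thesis by (simp add: h_def)
  next
    case False
    have "(\<integral>x. h s x \<partial>M) = (\<integral>x. N / K * ((p s x)\<^sup>2 / q x) \<partial>M)
      + (\<integral>x. p s x * (ln K - 2) \<partial>M) + (\<integral>x. 1 / N * (p s x / r s) \<partial>M)"
      unfolding h_def using False int[OF that] int_sq[OF that]
      by (simp del: times_divide_eq_left times_divide_eq_right)
    also have "\<dots> = N / K * (\<integral>x. (p s x)\<^sup>2 / q x \<partial>M) + r s * (ln K - 2) + 1 / N * (r s / r s)"
      unfolding r_def
      by (simp del: times_divide_eq_left times_divide_eq_right)
    finally show ?thesis using False by simp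
  qed
  then have "(\<Sum>s\<in>S. \<integral>x. h s x \<partial>M)
      \<le> (\<Sum>s\<in>S. N / K * (\<integral>x. (p s x)\<^sup>2 / q x \<partial>M) + r s * (ln K - 2) + 1 / N)"
    by (rule sum_mono)
  also have "\<dots> = N / K * (\<integral>x. (\<Sum>s\<in>S. (p s x)\<^sup>2 / q x) \<partial>M) + (ln K - 2) + 1"
  proof -
    have "(\<Sum>s\<in>S. N / K * (\<integral>x. (p s x)\<^sup>2 / q x \<partial>M)) = N / K * (\<integral>x. (\<Sum>s\<in>S. (p s x)\<^sup>2 / q x) \<partial>M)"
      using int_sq by (subst Bochner_Integration.integral_sum) (auto simp only: sum_distrib_left)
    moreover have "(\<Sum>s\<in>S. r s * (ln K - 2)) = ln K - 2"
      using total by (simp add: r_def flip: sum_distrib_right)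
    moreover have "(\<Sum>s\<in>S. 1 / N) = 1" using N by (simp add: N_def)
    ultimately show ?thesis by (simp only: sum.distrib)
  qed
  \<comment> \<open>The collision hypothesis, divided by \<open>N * q x\<close>.\<close>
  also have "(\<integral>x. (\<Sum>s\<in>S. (p s x)\<^sup>2 / q x) \<partial>M) \<le> (\<integral>x. K / N * q x \<partial>M)"
  proof (rule integral_mono)
    show "integrable M (\<lambda>x. \<Sum>s\<in>S. (p s x)\<^sup>2 / q x)" using int_sq by simp
    show "integrable M (\<lambda>x. K / N * q x)" unfolding q_def using int by simp
    show "(\<Sum>s\<in>S. (p s x)\<^sup>2 / q x) \<le> K / N * q x" if "x \<in> space M" for x
    proof (cases "q x = 0")
      case False
      moreover have "0 \<le> q x" unfolding q_def by (intro sum_nonneg nonneg that)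
      ultimately have "0 < q x" by simp
      with collision[OF that] N show ?thesis
        by (simp add: q_def[symmetric] N_def[symmetric] field_simps power2_eq_square flip: sum_divide_distrib)
    qed simp
  qed
  also have "(\<integral>x. K / N * q x \<partial>M) = K / N"
    unfolding q_def using int total by simp
  finally have "(\<Sum>s\<in>S. \<integral>x. h s x \<partial>M) \<le> ln K"
    using N K by (simp add: divide_le_eq)
  then have "(\<Sum>s\<in>S. \<integral>x. h s x / ln 2 \<partial>M) \<le> log 2 K"
    by (simp add: log_def divide_right_mono flip: sum_divide_distrib)
  moreover have "f s \<in> borel_measurable M" if "s \<in> S" for s
  proof -
    have "(\<lambda>x. p s x * log 2 (p s x / (q x * r s))) \<in> borel_measurable M" using that by measurable
    then show ?thesis
      by (rule measurable_cong[THEN iffD1, rotated]) (simp add: f that q_def r_def)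
  qed
  moreover have "f s x \<le> h s x / ln 2" if "s \<in> S" "x \<in> space M" for s x
    using divide_right_mono[OF log_likelihood_le[OF nonneg[OF that] le_q[OF that] r[OF that(1)] K N], of "ln 2"]
    by (simp add: f[OF that] h_def log_def q_def r_def)
  ultimately show ?thesis
    using S int_h by (intro nn_integral_diff_le[where g = "\<lambda>s x. h s x / ln 2"]) auto
qed

section \<open>Mutual information with a finite index set\<close>

text \<open>A countable cover by Borel sets of finite measure also serves the completed measure.
  Tonelli's theorem for continuous index sets relies on this.\<close>

lemma sigma_finite_lebesgue: "sigma_finite_measure (lebesgue :: 'a::euclidean_space measure)"
proof
  obtain A :: "'a set set" where "countable A" "A \<subseteq> sets lborel" "\<Union>A = space lborel"
    "\<forall>a\<in>A. emeasure lborel a \<noteq> \<infinity>"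
    using lborel.sigma_finite_countable by blast
  then show "\<exists>A::'a set set. countable A \<and> A \<subseteq> sets lebesgue \<and> \<Union>A = space lebesgue \<and>
      (\<forall>a\<in>A. emeasure lebesgue a \<noteq> \<infinity>)"
    by (intro exI[of _ A]) (auto simp: subset_iff)
qed

lemma index_measure_count_space: "finite S \<Longrightarrow> index_measure (count_space S)"
  unfolding index_measure_def using countable_finite by blast

lemma index_measure_sigma_finite: "index_measure M \<Longrightarrow> sigma_finite_measure M"
  unfolding index_measure_def
  by (auto intro: sigma_finite_measure_count_space_countable sigma_finite_measure_restrict_space
      sigma_finite_lebesgue)

lemma borel_measurable_trace_mult [measurable (raw)]:
  fixes f g :: "'a \<Rightarrow> complex^'n^'n"
  assumes "f \<in> borel_measurable M" "g \<in> borel_measurable M"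
  shows "(\<lambda>x. trace (f x ** g x)) \<in> borel_measurable M"
  using assms
  by (rule borel_measurable_continuous_Pair)
     (simp add: trace_def matrix_matrix_mult_def, intro continuous_intros)

lemma borel_measurable_trace [measurable (raw)]:
  fixes f :: "'a \<Rightarrow> complex^'n^'n"
  assumes "f \<in> borel_measurable M"
  shows "(\<lambda>x. trace (f x)) \<in> borel_measurable M"
  using borel_measurable_trace_mult[OF assms borel_measurable_const[of "mat 1"]] by simp

lemma mutual_information_integrand_measurable [measurable]:
  fixes \<rho> Q :: "real \<Rightarrow> complex^'n^'n"
  assumes [measurable]: "\<rho> \<in> borel_measurable M" "Q \<in> borel_measurable N"
  shows "mutual_information_integrand M \<rho> Q \<in> borel_measurable (M \<Otimes>\<^sub>M N)"
  unfolding mutual_information_integrand_def Let_def by measurable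

text \<open>Tonelli's theorem turns the product integral into the finite sum of integrals that
  \<open>information_le_log\<close> expects.\<close>

lemma mutual_info_finite_left:
  fixes \<rho> Q :: "real \<Rightarrow> complex^'n^'n"
  assumes "finite S" "sigma_finite_measure N" and [measurable]: "Q \<in> borel_measurable N"
  shows "mutual_info (count_space S) \<rho> N Q =
    enn2ereal (\<Sum>x\<in>S. \<integral>\<^sup>+y. ennreal (mutual_information_integrand (count_space S) \<rho> Q (x, y)) \<partial>N)
    - enn2ereal (\<Sum>x\<in>S. \<integral>\<^sup>+y. ennreal (- mutual_information_integrand (count_space S) \<rho> Q (x, y)) \<partial>N)"
proof -
  interpret N: sigma_finite_measure N by fact
  have [measurable]: "\<rho> \<in> borel_measurable (count_space S)" by simp
  show ?thesis
    unfolding mutual_info_def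
    by (subst (1 2) N.nn_integral_fst[symmetric]) (simp_all add: nn_integral_count_space_finite assms(1))
qed

lemma mutual_info_finite_right:
  fixes \<rho> Q :: "real \<Rightarrow> complex^'n^'n"
  assumes "finite S" "sigma_finite_measure M" and [measurable]: "\<rho> \<in> borel_measurable M"
  shows "mutual_info M \<rho> (count_space S) Q =
    enn2ereal (\<Sum>y\<in>S. \<integral>\<^sup>+x. ennreal (mutual_information_integrand M \<rho> Q (x, y)) \<partial>M)
    - enn2ereal (\<Sum>y\<in>S. \<integral>\<^sup>+x. ennreal (- mutual_information_integrand M \<rho> Q (x, y)) \<partial>M)"
proof -
  interpret M: sigma_finite_measure M by fact
  interpret S: sigma_finite_measure "count_space S"
    by (rule sigma_finite_measure_count_space_finite) fact
  interpret pair_sigma_finite M "count_space S" ..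
  have [measurable]: "Q \<in> borel_measurable (count_space S)" by simp
  show ?thesis
    unfolding mutual_info_def
    by (subst (1 2) nn_integral_snd[symmetric]) (simp_all add: nn_integral_count_space_finite assms(1))
qed

text \<open>On the support of the joint distribution the likelihood ratio is the constant
  \<open>K\<close>, so the integrand is \<open>log 2 K\<close> times a distribution of total mass
  one. Since \<open>1 \<le> K\<close>, the negative part is zero.\<close>

lemma mutual_info_flat:
  fixes \<rho> Q :: "real \<Rightarrow> complex^'n^'n"
  assumes S: "finite S" and T: "finite T" and K: "1 \<le> K"
    and nonneg: "\<And>x y. x \<in> S \<Longrightarrow> y \<in> T \<Longrightarrow> 0 \<le> Re (trace (\<rho> x ** Q y))"
    and flat: "\<And>x y. x \<in> S \<Longrightarrow> y \<in> T \<Longrightarrow> Re (trace (\<rho> x ** Q y)) \<noteq> 0 \<Longrightarrow>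
      Re (trace (\<rho> x ** Q y)) =
        K * (Re (trace (\<rho> x)) * Re (trace (average_state (count_space S) \<rho> ** Q y)))"
    and total: "(\<Sum>x\<in>S. \<Sum>y\<in>T. Re (trace (\<rho> x ** Q y))) = 1"
  shows "mutual_info (count_space S) \<rho> (count_space T) Q = ereal (log 2 K)"
proof -
  let ?I = "mutual_information_integrand (count_space S) \<rho> Q"
  define p where "p x y = Re (trace (\<rho> x ** Q y))" for x y
  have I: "?I (x, y) = p x y * log 2 K" if "x \<in> S" "y \<in> T" for x y
  proof (cases "p x y = 0")
    case True
    then show ?thesis by (simp add: mutual_information_integrand_def p_def Let_def)
  next
    case False
    let ?q = "Re (trace (\<rho> x)) * Re (trace (average_state (count_space S) \<rho> ** Q y))"
    have "p x y = K * ?q" using flat[OF that] False by (simp add: p_def)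
    with False have "p x y / ?q = K" by (cases "?q = 0") auto
    then show ?thesis by (simp add: mutual_information_integrand_def p_def Let_def)
  qed
  have pos: "0 \<le> p x y * log 2 K" if "x \<in> S" "y \<in> T" for x y
    using nonneg[OF that] K by (simp add: p_def)
  have "(\<Sum>x\<in>S. \<integral>\<^sup>+y. ennreal (?I (x, y)) \<partial>count_space T)
      = (\<Sum>x\<in>S. \<Sum>y\<in>T. ennreal (p x y * log 2 K))"
    by (simp add: nn_integral_count_space_finite T I)
  also have "\<dots> = ennreal (\<Sum>x\<in>S. \<Sum>y\<in>T. p x y * log 2 K)"
    using pos by (simp add: sum_ennreal sum_nonneg)
  also have "(\<Sum>x\<in>S. \<Sum>y\<in>T. p x y * log 2 K) = log 2 K"
    using total by (simp add: p_def flip: sum_distrib_right)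
  finally have P: "(\<Sum>x\<in>S. \<integral>\<^sup>+y. ennreal (?I (x, y)) \<partial>count_space T) = ennreal (log 2 K)" .
  have M: "(\<Sum>x\<in>S. \<integral>\<^sup>+y. ennreal (- ?I (x, y)) \<partial>count_space T) = 0"
    using pos by (simp add: nn_integral_count_space_finite T I ennreal_neg)
  show ?thesis
    using K by (subst mutual_info_finite_left)
      (simp_all add: S T P M sigma_finite_measure_count_space_finite enn2ereal_ennreal zero_ennreal.rep_eq)
qed

section \<open>The upper bounds\<close>

lemma Re_trace_mult_commute_eq_inner:
  assumes "hermitian B"
  shows "Re (trace (A ** B)) = B \<bullet> A"
  using Re_trace_mult_eq_inner[OF assms, of A] trace_mul_sym[of A B] by simp

lemma average_state_finite: "finite S \<Longrightarrow> average_state (count_space S) \<rho> = (\<Sum>x\<in>S. \<rho> x)"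
  by (simp add: average_state_def lebesgue_integral_count_space_finite)

text \<open>An ensemble is only required to have an integrable trace; for positive semidefinite
  matrices the trace dominates the norm.\<close>

lemma ensemble_integrable:
  assumes "ensemble M \<rho>"
  shows "integrable M \<rho>"
proof (rule Bochner_Integration.integrable_bound)
  show "integrable M (\<lambda>x. trace (\<rho> x))" "\<rho> \<in> borel_measurable M"
    using assms by (auto simp: ensemble_def has_bochner_integral_iff)
  have "norm (\<rho> x) \<le> norm (trace (\<rho> x))" if "x \<in> space M" for x
  proof -
    have "psd (\<rho> x)" using assms that by (simp add: ensemble_def state_def)
    from psd_norm_le[OF this] have "norm (\<rho> x) \<le> Re (trace (\<rho> x))"
      by (simp add: Re_trace_eq_inner)
    then show ?thesis using complex_Re_le_cmod order_trans by blast
  qed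
  then show "AE x in M. norm (\<rho> x) \<le> norm (trace (\<rho> x))" by simp
qed

context sic
begin

lemma collision:
  "psd A \<Longrightarrow> real (card S) * (\<Sum>x\<in>S. (X x \<bullet> A)\<^sup>2) \<le> 2 * d / (d + 1) * (\<Sum>x\<in>S. X x \<bullet> A)\<^sup>2"
  using sum_squares by (simp add: card_S)

lemma Re_trace_X_mult: "x \<in> S \<Longrightarrow> Re (trace (X x ** A)) = X x \<bullet> A"
  by (simp add: Re_trace_mult_eq_inner psd_hermitian psd_X)

lemma Re_trace_mult_X: "x \<in> S \<Longrightarrow> Re (trace (A ** X x)) = X x \<bullet> A"
  by (simp add: Re_trace_mult_commute_eq_inner psd_hermitian psd_X)

lemma sum_inner_X: "(\<Sum>x\<in>S. X x \<bullet> A) = d * t * (A \<bullet> mat 1)"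
  unfolding inner_sum_left[symmetric] sum_X by (simp add: inner_commute[of _ A])

lemma Re_trace_average_mult: "Re (trace (average_state (count_space S) X ** A)) = d * t * (A \<bullet> mat 1)"
  using Re_trace_mult_eq_inner[OF hermitian_scaleR[OF hermitian_mat_1], of "d * t" A]
  by (simp add: average_state_finite finite_S sum_X inner_commute[of _ A])

text \<open>Each effect is positive semidefinite, so it can take the place of the state in
  \<open>collision\<close>. The marginal of the SIC index is the constant \<open>t\<close>.\<close>

lemma mutual_info_ensemble_le:
  fixes Q :: "real \<Rightarrow> complex^'n^'n"
  assumes "t = 1 / d\<^sup>2" and Q: "povm N Q"
  shows "mutual_info (count_space S) X N Q \<le> ereal (log 2 (2 * d / (d + 1)))"
proof -
  have int: "integrable N Q" and lint: "integral\<^sup>L N Q = mat 1"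
    using Q by (auto simp: povm_def has_bochner_integral_iff)
  have psd: "psd (Q y)" if "y \<in> space N" for y
    using Q that by (simp add: povm_def effect_def)
  have p: "(\<integral>y. X s \<bullet> Q y \<partial>N) = t" if "s \<in> S" for s
    using int inner_X_1[OF that] by (simp add: lint)
  show ?thesis
    unfolding mutual_info_finite_left[OF finite_S index_measure_sigma_finite, of N Q X,
        OF Q[unfolded povm_def, THEN conjunct1] Q[unfolded povm_def, THEN conjunct2, THEN conjunct1]]
  proof (rule information_le_log[where p = "\<lambda>s y. X s \<bullet> Q y"])
    show "(\<Sum>s\<in>S. \<integral>y. X s \<bullet> Q y \<partial>N) = 1"
      using d by (simp add: p card_S assms(1))
    show "mutual_information_integrand (count_space S) X Q (s, y) =
        X s \<bullet> Q y * log 2 (X s \<bullet> Q y / ((\<Sum>s\<in>S. X s \<bullet> Q y) * (\<integral>y. X s \<bullet> Q y \<partial>N)))"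
      if "s \<in> S" "y \<in> space N" for s y
      using that
      by (simp add: mutual_information_integrand_def Let_def Re_trace_X_mult Re_trace_average_mult
          trace_X sum_inner_X p mult.commute)
  qed (use S_nonempty d int psd collision in \<open>simp_all add: finite_S inner_X_nonneg\<close>)
qed

text \<open>The dual case: the SIC index is now the outcome, and \<open>collision\<close> is applied
  to each state of the ensemble.\<close>

lemma mutual_info_povm_le:
  fixes \<rho> :: "real \<Rightarrow> complex^'n^'n"
  assumes "t = 1 / d" and \<rho>: "ensemble M \<rho>"
  shows "mutual_info M \<rho> (count_space S) X \<le> ereal (log 2 (2 * d / (d + 1)))"
proof -
  have int: "integrable M \<rho>" by (rule ensemble_integrable[OF \<rho>])
  have psd: "psd (\<rho> x)" if "x \<in> space M" for x
    using \<rho> that by (simp add: ensemble_def state_def)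
  have p: "(\<integral>x. X s \<bullet> \<rho> x \<partial>M) = X s \<bullet> average_state M \<rho>" for s
    using int by (simp add: average_state_def)
  have sum: "(\<Sum>s\<in>S. X s \<bullet> A) = Re (trace A)" for A
    using d by (simp add: sum_inner_X assms(1) Re_trace_eq_inner)
  show ?thesis
    unfolding mutual_info_finite_right[OF finite_S index_measure_sigma_finite, of M \<rho> X,
        OF \<rho>[unfolded ensemble_def, THEN conjunct1] \<rho>[unfolded ensemble_def, THEN conjunct2, THEN conjunct1]]
  proof (rule information_le_log[where p = "\<lambda>s x. X s \<bullet> \<rho> x"])
    have "(\<Sum>s\<in>S. \<integral>x. X s \<bullet> \<rho> x \<partial>M) = average_state M \<rho> \<bullet> mat 1"
      unfolding p sum Re_trace_eq_inner ..
    also have "\<dots> = (\<integral>x. Re (trace (\<rho> x)) \<partial>M)"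
      using int by (simp add: average_state_def Re_trace_eq_inner)
    also have "\<dots> = 1"
      using \<rho> integral_Re[of M "\<lambda>x. trace (\<rho> x)"] by (simp add: ensemble_def has_bochner_integral_iff)
    finally show "(\<Sum>s\<in>S. \<integral>x. X s \<bullet> \<rho> x \<partial>M) = 1" .
    show "mutual_information_integrand M \<rho> X (x, s) =
        X s \<bullet> \<rho> x * log 2 (X s \<bullet> \<rho> x / ((\<Sum>s\<in>S. X s \<bullet> \<rho> x) * (\<integral>x. X s \<bullet> \<rho> x \<partial>M)))"
      if "s \<in> S" "x \<in> space M" for s x
      using that
      by (simp add: mutual_information_integrand_def Let_def Re_trace_mult_X sum p)
  qed (use S_nonempty d int psd collision in \<open>simp_all add: finite_S inner_X_nonneg\<close>)
qed

end

section \<open>Tightness in dimension two\<close>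

text \<open>An orthonormal basis resolves the identity; the defect \<open>?Z\<close> has norm zero
  by its known inner products.\<close>

lemma ketbra_orthogonal:
  fixes u v :: "complex^'n"
  assumes "CARD('n) = 2" "norm u = 1" "norm v = 1" "cinner u v = 0"
  shows "ketbra v = mat 1 - ketbra u"
proof -
  let ?Z = "ketbra v + ketbra u - mat 1"
  have "ketbra u \<bullet> ketbra u = 1" "ketbra v \<bullet> ketbra v = 1" "ketbra u \<bullet> ketbra v = 0"
    using assms by (simp_all add: inner_ketbra_ketbra cinner_self)
  moreover have "ketbra u \<bullet> mat 1 = 1" "ketbra v \<bullet> mat 1 = 1"
    using assms by (simp_all add: inner_ketbra_mat_1)
  moreover have "mat 1 \<bullet> (mat 1 :: complex^'n^'n) = 2"
    by (simp add: inner_mat_1 assms(1))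
  ultimately have "?Z \<bullet> ?Z = 0"
    by (simp add: inner_diff inner_add inner_commute)
  then have "?Z = 0" by (simp only: inner_eq_zero_iff)
  then show ?thesis by (simp add: algebra_simps)
qed

lemma ex_orthogonal:
  fixes u :: "complex^'n"
  assumes "CARD('n) = 2" "norm u = 1"
  obtains v where "norm v = 1" "cinner u v = 0"
proof -
  obtain i j where ij: "(UNIV :: 'n set) = {i, j}" "i \<noteq> j"
    using assms(1) by (auto simp: card_2_iff)
  \<comment> \<open>The conjugated quarter turn of \<open>u\<close>: its two products with
    \<open>u\<close> cancel.\<close>
  define v where "v = (\<chi> k. if k = i then - cnj (u $ j) else cnj (u $ i))"
  have "norm v = norm u" "cinner u v = 0"
    using ij(2) by (simp_all add: norm_vec_def L2_set_def cinner_def ij(1) v_def)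
  with assms(2) that show ?thesis by simp
qed

context sic
begin

text \<open>Provides the point at which the suprema are attained and keeps the claims about all
  antitetrahedral families from being vacuous.\<close>

lemma ex_antitetrahedral:
  assumes "CARD('n) = 2"
  shows "\<exists>\<psi>. antitetrahedral X \<psi>"
proof -
  have S4: "upto_index 4 = S" by (simp add: S_def assms)
  have "\<exists>u. norm u = 1 \<and> X y = t *\<^sub>R ketbra u" if "y \<in> S" for y
    using rank_one[OF that] by metis
  then obtain \<pi> where \<pi>: "y \<in> S \<Longrightarrow> norm (\<pi> y) = 1 \<and> X y = t *\<^sub>R ketbra (\<pi> y)" for y
    by metis
  then have "\<exists>v. norm v = 1 \<and> cinner (\<pi> y) v = 0" if "y \<in> S" for y
    using ex_orthogonal[OF assms] that by metis
  then obtain \<psi> where "y \<in> S \<Longrightarrow> norm (\<psi> y) = 1 \<and> cinner (\<pi> y) (\<psi> y) = 0" for y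
    by metis
  with \<pi> show ?thesis
    unfolding antitetrahedral_def S4 by (intro exI[of _ \<psi>] exI[of _ \<pi>] exI[of _ id]) auto
qed

text \<open>\<open>antitetrahedral\<close> leaves the scalars and the phases open. The trace forces
  each scalar to be \<open>t\<close>, and \<open>ketbra\<close> does not see phases, so the
  projectors are determined up to relabeling.\<close>

lemma antitetrahedral_ketbra:
  assumes "CARD('n) = 2" "antitetrahedral X \<psi>"
  obtains \<sigma> where "bij_betw \<sigma> S S"
    and "\<And>x. x \<in> S \<Longrightarrow> ketbra (\<psi> x) = mat 1 - (1 / t) *\<^sub>R X (\<sigma> x)"
    and "\<And>x. x \<in> S \<Longrightarrow> norm (\<psi> x) = 1"
proof -
  have S4: "upto_index 4 = S" by (simp add: S_def assms(1))
  from assms(2) obtain \<pi> \<sigma> where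
    \<pi>: "\<And>y. y \<in> S \<Longrightarrow> norm (\<pi> y) = 1 \<and> (\<exists>c::real. X y = c *\<^sub>R ketbra (\<pi> y))"
    and \<sigma>: "bij_betw \<sigma> S S"
    and \<psi>: "\<And>x. x \<in> S \<Longrightarrow> norm (\<psi> x) = 1 \<and> cinner (\<pi> (\<sigma> x)) (\<psi> x) = 0"
    unfolding antitetrahedral_def S4 by blast
  have X: "X y = t *\<^sub>R ketbra (\<pi> y)" if y: "y \<in> S" for y
  proof -
    obtain c where c: "X y = c *\<^sub>R ketbra (\<pi> y)" using \<pi>[OF y] by blast
    then have "t = c"
      using inner_X_1[OF y] \<pi>[OF y] by (simp add: inner_ketbra_mat_1)
    with c show ?thesis by simp
  qed
  have "ketbra (\<psi> x) = mat 1 - (1 / t) *\<^sub>R X (\<sigma> x)" if "x \<in> S" for x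
  proof -
    have "\<sigma> x \<in> S" using \<sigma> that by (auto simp: bij_betw_def)
    then show ?thesis
      using ketbra_orthogonal[OF assms(1), of "\<pi> (\<sigma> x)" "\<psi> x"] \<pi> \<psi>[OF that] t by (simp add: X)
  qed
  with that \<sigma> \<psi> show ?thesis by blast
qed

text \<open>Everything follows by writing each projector as the complement of a rescaled SIC
  operator. The inner product is \<open>0\<close> for \<open>y = \<sigma> x\<close> and
  \<open>t - t / 3\<close> otherwise.\<close>

lemma antitetrahedral_props:
  assumes "CARD('n) = 2" "antitetrahedral X \<psi>"
  shows sum_antitetrahedral: "(\<Sum>x\<in>S. ketbra (\<psi> x)) = 2 *\<^sub>R mat 1"
    and antitetrahedral_inner_1: "x \<in> S \<Longrightarrow> ketbra (\<psi> x) \<bullet> mat 1 = 1"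
    and antitetrahedral_inner: "x \<in> S \<Longrightarrow> y \<in> S \<Longrightarrow> X y \<bullet> ketbra (\<psi> x) \<in> {0, 2 * t / 3}"
    and effect_antitetrahedral: "x \<in> S \<Longrightarrow> effect ((1 / 2) *\<^sub>R ketbra (\<psi> x))"
proof -
  obtain \<sigma> where \<sigma>: "bij_betw \<sigma> S S"
    and \<psi>: "\<And>x. x \<in> S \<Longrightarrow> ketbra (\<psi> x) = mat 1 - (1 / t) *\<^sub>R X (\<sigma> x)"
    and norm: "\<And>x. x \<in> S \<Longrightarrow> norm (\<psi> x) = 1"
    using antitetrahedral_ketbra[OF assms] by metis
  have d2: "d = 2" by (simp add: d_def assms(1))
  have \<sigma>S: "\<sigma> x \<in> S" if "x \<in> S" for x using \<sigma> that by (auto simp: bij_betw_def)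
  have "(\<Sum>x\<in>S. X (\<sigma> x)) = (\<Sum>x\<in>S. X x)" by (rule sum.reindex_bij_betw[OF \<sigma>])
  then have "(\<Sum>x\<in>S. ketbra (\<psi> x)) = real (card S) *\<^sub>R mat 1 - 2 *\<^sub>R mat 1"
    using t by (simp add: \<psi> sum_subtractf sum_X d2 sum_constant_scaleR flip: scaleR_sum_right del: sum_constant)
  also have "\<dots> = (4 - 2) *\<^sub>R mat 1" unfolding card_S d2 scaleR_left_diff_distrib by simp
  finally show "(\<Sum>x\<in>S. ketbra (\<psi> x)) = 2 *\<^sub>R mat 1" by simp
  show "ketbra (\<psi> x) \<bullet> mat 1 = 1" if "x \<in> S"
    using norm[OF that] by (simp add: inner_ketbra_mat_1)
  show "X y \<bullet> ketbra (\<psi> x) \<in> {0, 2 * t / 3}" if "x \<in> S" "y \<in> S"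
  proof -
    have "X y \<bullet> ketbra (\<psi> x) = t - 1 / t * (t\<^sup>2 / 3 * ((if y = \<sigma> x then 2 else 0) + 1))"
      using that by (simp add: \<psi> inner_diff inner_X_1 inner_X \<sigma>S d2)
    then show ?thesis using t by (simp add: power2_eq_square)
  qed
  show "effect ((1 / 2) *\<^sub>R ketbra (\<psi> x))" if "x \<in> S"
  proof -
    \<comment> \<open>The complement is exhibited as a sum of two positive semidefinite
      matrices.\<close>
    have "mat 1 - (1 / 2) *\<^sub>R ketbra (\<psi> x) = (1 / 2) *\<^sub>R mat 1 + (1 / (2 * t)) *\<^sub>R X (\<sigma> x)"
      using scaleR_left_distrib[of "1/2" "1/2" "mat 1 :: complex^'n^'n"]
      by (simp add: \<psi>[OF that] scaleR_right_diff_distrib)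
    moreover have "psd ((1 / 2) *\<^sub>R mat 1 + (1 / (2 * t)) *\<^sub>R X (\<sigma> x))"
      using t by (intro psd_add psd_scaleR psd_mat_1 psd_X \<sigma>S that) auto
    ultimately show ?thesis by (simp add: effect_def psd_ketbra)
  qed
qed

section \<open>The antitetrahedral POVM and ensemble and their mutual information\<close>

lemma povm_antitetrahedral:
  assumes "CARD('n) = 2" "antitetrahedral X \<psi>"
  shows "povm (count_space S) (\<lambda>x. (1 / 2) *\<^sub>R ketbra (\<psi> x))"
  by (simp add: povm_def index_measure_count_space has_bochner_integral_iff integrable_count_space
      lebesgue_integral_count_space_finite finite_S effect_antitetrahedral[OF assms]
      sum_antitetrahedral[OF assms])

lemma ensemble_antitetrahedral:
  assumes "CARD('n) = 2" "antitetrahedral X \<psi>"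
  shows "ensemble (count_space S) (\<lambda>x. (1 / 4) *\<^sub>R ketbra (\<psi> x))"
proof -
  obtain \<sigma> where "\<And>x. x \<in> S \<Longrightarrow> norm (\<psi> x) = 1"
    using antitetrahedral_ketbra[OF assms] by metis
  then have tr: "x \<in> S \<Longrightarrow> trace ((1 / 4) *\<^sub>R ketbra (\<psi> x)) = 1 / 4" for x
    by (simp add: trace_ketbra)
  have "card S = 4"
  proof -
    have "real (card S) = real 4" unfolding card_S by (simp add: d_def assms(1))
    then show ?thesis by (simp only: of_nat_eq_iff)
  qed
  then show ?thesis
    using finite_S
    by (auto simp: tr ensemble_def index_measure_count_space has_bochner_integral_iff integrable_count_space
        lebesgue_integral_count_space_finite state_def psd_ketbra)
qed

text \<open>Joint probabilities are \<open>0\<close> or \<open>1 / 12\<close> and both marginals are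
  \<open>1 / 4\<close>, so the likelihood ratio on the support is \<open>4 / 3\<close>.\<close>

lemma mutual_info_antitetrahedral_povm:
  assumes "t = 1 / 4" "CARD('n) = 2" "antitetrahedral X \<psi>"
  shows "mutual_info (count_space S) X (count_space S) (\<lambda>x. (1 / 2) *\<^sub>R ketbra (\<psi> x)) = ereal (log 2 (4 / 3))"
proof (rule mutual_info_flat)
  note [simp] = Re_trace_X_mult Re_trace_average_mult trace_X
    antitetrahedral_inner_1[OF assms(2,3)] sum_antitetrahedral[OF assms(2,3)]
  have d2: "d = 2" by (simp add: d_def assms(2))
  have in_set: "X x \<bullet> ketbra (\<psi> y) \<in> {0, 1 / 6}" if "x \<in> S" "y \<in> S" for x y
    using antitetrahedral_inner[OF assms(2,3) that(2,1)] by (simp add: assms(1))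
  show "0 \<le> Re (trace (X x ** ((1 / 2) *\<^sub>R ketbra (\<psi> y))))" if "x \<in> S" "y \<in> S" for x y
    using in_set[OF that] that by auto
  show "Re (trace (X x ** ((1 / 2) *\<^sub>R ketbra (\<psi> y)))) = 4 / 3 * (Re (trace (X x)) *
      Re (trace (average_state (count_space S) X ** ((1 / 2) *\<^sub>R ketbra (\<psi> y)))))"
    if "x \<in> S" "y \<in> S" "Re (trace (X x ** ((1 / 2) *\<^sub>R ketbra (\<psi> y)))) \<noteq> 0" for x y
    using in_set[OF that(1,2)] that by (auto simp: d2 assms(1))
  have "(\<Sum>x\<in>S. \<Sum>y\<in>S. X x \<bullet> ketbra (\<psi> y)) = 2"
    by (simp add: inner_X_1 card_S d2 assms(1) flip: inner_sum_right)
  then show "(\<Sum>x\<in>S. \<Sum>y\<in>S. Re (trace (X x ** ((1 / 2) *\<^sub>R ketbra (\<psi> y))))) = 1"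
    by (simp flip: sum_divide_distrib)
qed (simp_all add: finite_S)

lemma mutual_info_antitetrahedral_ensemble:
  assumes "t = 1 / 2" "CARD('n) = 2" "antitetrahedral X \<psi>"
  shows "mutual_info (count_space S) (\<lambda>x. (1 / 4) *\<^sub>R ketbra (\<psi> x)) (count_space S) X = ereal (log 2 (4 / 3))"
proof (rule mutual_info_flat)
  have tr: "Re (trace ((1 / 4) *\<^sub>R ketbra (\<psi> x))) = 1 / 4" if "x \<in> S" for x
    using antitetrahedral_inner_1[OF assms(2,3) that] by (simp add: Re_trace_eq_inner)
  note [simp] = tr Re_trace_mult_X average_state_finite[OF finite_S]
    antitetrahedral_inner_1[OF assms(2,3)] sum_antitetrahedral[OF assms(2,3)]
  have d2: "d = 2" by (simp add: d_def assms(2))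
  have in_set: "X y \<bullet> ketbra (\<psi> x) \<in> {0, 1 / 3}" if "x \<in> S" "y \<in> S" for x y
    using antitetrahedral_inner[OF assms(2,3) that] by (simp add: assms(1))
  show "0 \<le> Re (trace (((1 / 4) *\<^sub>R ketbra (\<psi> x)) ** X y))" if "x \<in> S" "y \<in> S" for x y
    using in_set[OF that] that by auto
  have avg: "(\<Sum>x\<in>S. (1 / 4) *\<^sub>R ketbra (\<psi> x)) = (1 / 2) *\<^sub>R mat 1"
    by (simp flip: scaleR_sum_right)
  show "Re (trace (((1 / 4) *\<^sub>R ketbra (\<psi> x)) ** X y)) = 4 / 3 * (Re (trace ((1 / 4) *\<^sub>R ketbra (\<psi> x))) *
      Re (trace (average_state (count_space S) (\<lambda>x. (1 / 4) *\<^sub>R ketbra (\<psi> x)) ** X y)))"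
    if "x \<in> S" "y \<in> S" "Re (trace (((1 / 4) *\<^sub>R ketbra (\<psi> x)) ** X y)) \<noteq> 0" for x y
    using in_set[OF that(1,2)] that by (auto simp: avg assms(1) inner_X_1)
  have "(\<Sum>x\<in>S. \<Sum>y\<in>S. X y \<bullet> ketbra (\<psi> x)) = 4"
    by (simp add: sum_inner_X card_S d2 assms(1))
  then show "(\<Sum>x\<in>S. \<Sum>y\<in>S. Re (trace (((1 / 4) *\<^sub>R ketbra (\<psi> x)) ** X y))) = 1"
    by (simp flip: sum_divide_distrib)
qed (simp_all add: finite_S)

section \<open>The suprema over all POVMs and over all ensembles\<close>

lemma accessible_information_le:
  assumes "t = 1 / d\<^sup>2"
  shows "accessible_information (count_space S) X \<le> ereal (log 2 (2 * d / (d + 1)))"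
  unfolding accessible_information_def
  by (rule SUP_least) (auto intro: mutual_info_ensemble_le[OF assms])

lemma informational_power_le:
  assumes "t = 1 / d"
  shows "informational_power (count_space S) X \<le> ereal (log 2 (2 * d / (d + 1)))"
  unfolding informational_power_def
  by (rule SUP_least) (auto intro: mutual_info_povm_le[OF assms])

lemma accessible_information_dim2:
  assumes "t = 1 / 4" "CARD('n) = 2"
  shows "accessible_information (count_space S) X = ereal (log 2 (4 / 3))"
proof (rule antisym)
  have d2: "d = 2" by (simp add: d_def assms(2))
  show "accessible_information (count_space S) X \<le> ereal (log 2 (4 / 3))"
    using accessible_information_le by (simp add: d2 assms(1))
  obtain \<psi> where \<psi>: "antitetrahedral X \<psi>" using ex_antitetrahedral[OF assms(2)] by blast
  show "ereal (log 2 (4 / 3)) \<le> accessible_information (count_space S) X"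
    using SUP_upper[of "(count_space S, \<lambda>x. (1 / 2) *\<^sub>R ketbra (\<psi> x))" _ "\<lambda>(N, Q). mutual_info (count_space S) X N Q"]
      povm_antitetrahedral[OF assms(2) \<psi>] mutual_info_antitetrahedral_povm[OF assms \<psi>]
    unfolding accessible_information_def by auto
qed

lemma informational_power_dim2:
  assumes "t = 1 / 2" "CARD('n) = 2"
  shows "informational_power (count_space S) X = ereal (log 2 (4 / 3))"
proof (rule antisym)
  have d2: "d = 2" by (simp add: d_def assms(2))
  show "informational_power (count_space S) X \<le> ereal (log 2 (4 / 3))"
    using informational_power_le by (simp add: d2 assms(1))
  obtain \<psi> where \<psi>: "antitetrahedral X \<psi>" using ex_antitetrahedral[OF assms(2)] by blast
  show "ereal (log 2 (4 / 3)) \<le> informational_power (count_space S) X"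
    using SUP_upper[of "(count_space S, \<lambda>x. (1 / 4) *\<^sub>R ketbra (\<psi> x))" _ "\<lambda>(M, \<rho>). mutual_info M \<rho> (count_space S) X"]
      ensemble_antitetrahedral[OF assms(2) \<psi>] mutual_info_antitetrahedral_ensemble[OF assms \<psi>]
    unfolding informational_power_def by auto
qed

end

theorem corollary1:
  fixes E P :: "real \<Rightarrow> complex^'n^'n"
  assumes "sic_ensemble E" and "sic_povm P"
  shows
    "accessible_information (upto_measure (CARD('n)\<^sup>2)) E \<le> ereal (log 2 (2 * real CARD('n) / (real CARD('n) + 1))) \<and>
     informational_power (upto_measure (CARD('n)\<^sup>2)) P \<le> ereal (log 2 (2 * real CARD('n) / (real CARD('n) + 1))) \<and>
     (CARD('n) = 2 \<longrightarrow>
        accessible_information (upto_measure 4) E = ereal (log 2 (4 / 3)) \<and>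
        informational_power (upto_measure 4) P = ereal (log 2 (4 / 3)) \<and>
        (\<exists>\<psi>. antitetrahedral E \<psi>) \<and>
        (\<forall>\<psi>. antitetrahedral E \<psi> \<longrightarrow>
           povm (upto_measure 4) (\<lambda>x. (1 / 2) *\<^sub>R ketbra (\<psi> x)) \<and>
           mutual_info (upto_measure 4) E (upto_measure 4) (\<lambda>x. (1 / 2) *\<^sub>R ketbra (\<psi> x))
             = accessible_information (upto_measure 4) E) \<and>
        (\<exists>\<psi>. antitetrahedral P \<psi>) \<and>
        (\<forall>\<psi>. antitetrahedral P \<psi> \<longrightarrow>
           ensemble (upto_measure 4) (\<lambda>x. (1 / 4) *\<^sub>R ketbra (\<psi> x)) \<and>
           mutual_info (upto_measure 4) (\<lambda>x. (1 / 4) *\<^sub>R ketbra (\<psi> x)) (upto_measure 4) P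
             = informational_power (upto_measure 4) P))"
proof -
  interpret E: sic "1 / (real CARD('n))\<^sup>2" E "upto_index (CARD('n)\<^sup>2)" "real CARD('n)"
    by unfold_locales (use assms(1) in \<open>simp_all add: sic_ensemble_def\<close>)
  interpret P: sic "1 / real CARD('n)" P "upto_index (CARD('n)\<^sup>2)" "real CARD('n)"
    by unfold_locales (use assms(2) in \<open>simp_all add: sic_povm_def\<close>)
  show ?thesis
  proof (intro conjI impI allI)
    assume two: "CARD('n) = 2"
    then have S: "upto_measure 4 = upto_measure (CARD('n)\<^sup>2)" by simp
    from two have t: "1 / (real CARD('n))\<^sup>2 = 1 / 4" "1 / real CARD('n) = 1 / 2" by simp_all
    show "accessible_information (upto_measure 4) E = ereal (log 2 (4 / 3))"
      unfolding S by (rule E.accessible_information_dim2[OF t(1) two])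
    show "informational_power (upto_measure 4) P = ereal (log 2 (4 / 3))"
      unfolding S by (rule P.informational_power_dim2[OF t(2) two])
    show "\<exists>\<psi>. antitetrahedral E \<psi>" "\<exists>\<psi>. antitetrahedral P \<psi>"
      by (rule E.ex_antitetrahedral[OF two] P.ex_antitetrahedral[OF two])+
    fix \<psi>
    show "povm (upto_measure 4) (\<lambda>x. (1 / 2) *\<^sub>R ketbra (\<psi> x))" if "antitetrahedral E \<psi>"
      unfolding S by (rule E.povm_antitetrahedral[OF two that])
    show "mutual_info (upto_measure 4) E (upto_measure 4) (\<lambda>x. (1 / 2) *\<^sub>R ketbra (\<psi> x))
        = accessible_information (upto_measure 4) E" if "antitetrahedral E \<psi>"
      unfolding S E.accessible_information_dim2[OF t(1) two]
      by (rule E.mutual_info_antitetrahedral_povm[OF t(1) two that])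
    show "ensemble (upto_measure 4) (\<lambda>x. (1 / 4) *\<^sub>R ketbra (\<psi> x))" if "antitetrahedral P \<psi>"
      unfolding S by (rule P.ensemble_antitetrahedral[OF two that])
    show "mutual_info (upto_measure 4) (\<lambda>x. (1 / 4) *\<^sub>R ketbra (\<psi> x)) (upto_measure 4) P
        = informational_power (upto_measure 4) P" if "antitetrahedral P \<psi>"
      unfolding S P.informational_power_dim2[OF t(2) two]
      by (rule P.mutual_info_antitetrahedral_ensemble[OF t(2) two that])
  \<comment> \<open>What remains are the two bounds in arbitrary dimension; the scale premise of
    each holds by reflexivity.\<close>
  qed (rule E.accessible_information_le P.informational_power_le, rule refl)+
qed

end
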